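(* Let $n\ge 2$ and let $A=(a_{ij})_{i,j=1}^n$ be a real symmetric matrix with $\mathrm{tr}(A)=0$. Let $g(x)=\sum_{i,j}a_{ij}x_ix_j$ and let $f=Cg$, where the constant $C$ is chosen so that $\|f\|_2=1$ when $f$ is regarded as a function on $S^{n-1}$ (i.e. $\mathbb{E}f(X)^2=1$ for $X$ uniform on $S^{n-1}$). Let $W=f(X)$ where $X$ is a uniformly random point of $S^{n-1}$, and let $Z$ be a standard Gaussian random variable. If $d\in\mathbb{R}^n$ is the vector whose entries are the eigenvalues of $A$, then $$d_{TV}(W,Z)\le\sqrt{6}\left(\frac{\|d\|_4}{\|d\|_2}\right)^2,$$ where $\|d\|_p=\left(\sum_i|d_i|^p\right)^{1/p}$.
   Context: $S^{n-1}\subseteq\mathbb{R}^n$ is the unit sphere with uniform (normalized surface) probability measure. For real random variables, $d_{TV}(X,Y)=\sup_A|\mathbb{P}(X\in A)-\mathbb{P}(Y\in A)|$ over measurable sets $A$. *)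

theory Defs
  imports "HOL-Probability.Probability"
begin

text \<open>Uniform (normalized surface) probability measure on the unit sphere of a
Euclidean space, realised as the cone measure: the pushforward of the uniform
probability measure on the unit ball under radial projection. For the Euclidean
sphere the cone measure coincides with normalized surface measure.\<close>
definition sphere_measure :: "('a::euclidean_space) measure" where
  "sphere_measure = distr (uniform_measure lborel (ball 0 1)) borel (\<lambda>x. x /\<^sub>R norm x)"

definition std_gaussian :: "real measure" where
  "std_gaussian = density lborel std_normal_density"

definition d_TV :: "real measure \<Rightarrow> real measure \<Rightarrow> real" where
  "d_TV M N = (SUP A \<in> sets borel. \<bar>measure M A - measure N A\<bar>)"

definition lp_norm :: "real \<Rightarrow> real ^ 'n \<Rightarrow> real" where
  "lp_norm p d = (\<Sum>i\<in>UNIV. \<bar>d $ i\<bar> powr p) powr (1 / p)"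

definition quad_form :: "real ^ 'n ^ 'n \<Rightarrow> real ^ 'n \<Rightarrow> real" where
  "quad_form A x = (\<Sum>i\<in>UNIV. \<Sum>j\<in>UNIV. A $ i $ j * x $ i * x $ j)"

end

theory Submission
  imports Defs "HOL-Real_Asymp.Real_Asymp"
begin

text \<open>
  By rotation invariance of the sphere one may take \<open>A\<close> diagonal with entries \<open>e\<close>. Differentiating
  \<open>E F(R\<^sub>t X) = E F(X)\<close> along plane rotations \<open>R\<^sub>t\<close> gives all moments that are needed, and also
  integration by parts: since a trace-free form \<open>g\<close> is an eigenfunction of the spherical Laplacian,
  \<open>E W h(W) = E h'(W) T\<close> with \<open>T = (2 C\<^sup>2 / n) (Q - g\<^sup>2)\<close>, \<open>Q = \<Sum> e\<^sub>k\<^sup>2 x\<^sub>k\<^sup>2\<close>. For a continuous test function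
  \<open>u\<close> with values in \<open>[0, 1]\<close> the Stein equation \<open>h' - w h = u - E u(Z)\<close> has a solution with
  \<open>\<bar>h'\<bar> \<le> 1\<close>, hence \<open>d_TV W Z \<le> E \<bar>1 - T\<bar>\<close>, and \<open>T\<close> has mean \<open>1\<close> and small fluctuations.
\<close>

section \<open>The uniform measure on the sphere\<close>

text \<open>\<open>T\<close> is the squared spherical gradient of \<open>W\<close> divided by
  \<open>2 * n\<close>, where \<open>- 2 * n\<close> is the eigenvalue of the Laplacian on
  trace-free quadratic forms; the choice \<open>h w = w\<close> in the integration by parts gives E
  T = E W^2 = 1. Test functions are continuous because the Stein solution for an indicator has a
  derivative with a jump, whereas the rotation argument asks for a continuous \<open>h'\<close>. The
  obstacle is the fluctuation of \<open>T\<close>. The variance of \<open>Q\<close> is explicit and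
  of the right size, but that of \<open>g\<^sup>2\<close> would require moments of order eight.
  After normalisation, however, \<open>g\<^sup>2\<close> contributes to \<open>T\<close> with mean
  only 2/n, and 1/n is at most r = (||d||_4 / ||d||_2)^4 by Cauchy-Schwarz. The claimed bound is
  sqrt (6 r), trivial for 6 r >= 1; for smaller r, products of r and 1/n are of lower order, so a
  crude treatment of \<open>g\<^sup>2\<close> is affordable.\<close>

lemma nn_integral_lborel_shift:
  fixes f :: "'a::euclidean_space \<Rightarrow> ennreal"
  assumes [measurable]: "f \<in> borel_measurable borel"
  shows "(\<integral>\<^sup>+x. f (x + a) \<partial>lborel) = (\<integral>\<^sup>+x. f x \<partial>lborel)"
proof -
  have "(\<integral>\<^sup>+x. f x \<partial>lborel) = (\<integral>\<^sup>+x. f x \<partial>distr lborel borel ((+) a))"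
    by (simp add: lborel_distr_plus)
  also have "\<dots> = (\<integral>\<^sup>+x. f (x + a) \<partial>lborel)"
    by (subst nn_integral_distr) (auto simp: add.commute)
  finally show ?thesis by simp
qed

lemma nn_integral_lborel_uminus:
  fixes f :: "'a::euclidean_space \<Rightarrow> ennreal"
  assumes [measurable]: "f \<in> borel_measurable borel"
  shows "(\<integral>\<^sup>+x. f (- x) \<partial>lborel) = (\<integral>\<^sup>+x. f x \<partial>lborel)"
proof -
  have "(\<integral>\<^sup>+x. f x \<partial>lborel) = (\<integral>\<^sup>+x. f x \<partial>density (distr lborel borel (\<lambda>x. 0 + (-1) *\<^sub>R x)) (\<lambda>_. \<bar>-1::real\<bar>^DIM('a)))"
    by (subst lborel_affine[of "-1" 0]) simp_all
  also have "\<dots> = (\<integral>\<^sup>+x. f (-x) \<partial>lborel)"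
    by (subst nn_integral_density) (auto simp: nn_integral_distr)
  finally show ?thesis by simp
qed

text \<open>Fubini on the product with \<open>lborel\<close>, shifting each variable in turn.\<close>
lemma shift_invariant_proportional:
  fixes M :: "'a::euclidean_space measure"
  assumes [measurable_cong]: "sets M = sets borel" and "sigma_finite_measure M"
    and shift: "\<And>f a. f \<in> borel_measurable borel \<Longrightarrow> (\<integral>\<^sup>+x. f (x + a) \<partial>M) = (\<integral>\<^sup>+x. f x \<partial>M)"
    and A[measurable]: "A \<in> sets borel" and B[measurable]: "B \<in> sets borel"
  shows "emeasure lborel A * emeasure M B = emeasure M A * emeasure lborel B"
proof -
  interpret sigma_finite_measure M by fact
  interpret pair_sigma_finite lborel M ..
  have "emeasure lborel A * emeasure M B = (\<integral>\<^sup>+x. indicator A x * (\<integral>\<^sup>+y. indicator B y \<partial>M) \<partial>lborel)"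
    by (simp add: nn_integral_multc assms(1))
  also have "\<dots> = (\<integral>\<^sup>+x. indicator A x * (\<integral>\<^sup>+y. indicator B (y + - x) \<partial>M) \<partial>lborel)"
    by (subst shift) auto
  also have "\<dots> = (\<integral>\<^sup>+x. (\<integral>\<^sup>+y. indicator A x * indicator B (y + - x) \<partial>M) \<partial>lborel)"
    by (subst nn_integral_cmult) auto
  also have "\<dots> = (\<integral>\<^sup>+y. (\<integral>\<^sup>+x. indicator A x * indicator B (y + - x) \<partial>lborel) \<partial>M)"
    by (rule Fubini'[symmetric]) auto
  also have "\<dots> = (\<integral>\<^sup>+y. (\<integral>\<^sup>+x. indicator A (x + y) * indicator B (y + - (x + y)) \<partial>lborel) \<partial>M)"
    by (subst nn_integral_lborel_shift) auto
  also have "\<dots> = (\<integral>\<^sup>+y. (\<integral>\<^sup>+x. indicator A (y + x) * indicator B (- x) \<partial>lborel) \<partial>M)"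
    by (simp add: add.commute)
  also have "\<dots> = (\<integral>\<^sup>+x. (\<integral>\<^sup>+y. indicator A (y + x) * indicator B (- x) \<partial>M) \<partial>lborel)"
    by (rule Fubini') auto
  also have "\<dots> = (\<integral>\<^sup>+x. (\<integral>\<^sup>+y. indicator A (y + x) \<partial>M) * indicator B (- x) \<partial>lborel)"
    by (subst nn_integral_multc) auto
  also have "\<dots> = (\<integral>\<^sup>+x. emeasure M A * indicator B (- x) \<partial>lborel)"
    by (subst shift) (auto simp: assms(1))
  also have "\<dots> = emeasure M A * emeasure lborel B"
    by (subst nn_integral_lborel_uminus) (auto simp: nn_integral_cmult)
  finally show ?thesis .
qed

section \<open>Orthogonal invariance of Lebesgue measure\<close>

lemma borel_measurable_orthogonal_transformation:
  fixes U :: "'a::euclidean_space \<Rightarrow> 'a"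
  assumes "orthogonal_transformation U"
  shows "U \<in> borel_measurable borel"
  using assms by (intro borel_measurable_continuous_onI linear_continuous_on)
    (auto simp: orthogonal_transformation_linear linear_conv_bounded_linear[symmetric])

lemma vimage_ball_orthogonal_transformation:
  fixes U :: "'a::euclidean_space \<Rightarrow> 'a"
  assumes "orthogonal_transformation U"
  shows "U -` ball 0 r = ball 0 r"
  using assms by (auto simp: orthogonal_transformation)

lemma emeasure_lborel_ball_pos:
  "0 < r \<Longrightarrow> emeasure lborel (ball (c::'a::euclidean_space) r) > 0"
  by (simp add: emeasure_ball unit_ball_vol_pos)

text \<open>The image measure inherits translation invariance, since a shift by \<open>a\<close>
  after \<open>U\<close> is a shift by \<open>V a\<close> before it, so it is a multiple of Lebesgue
  measure. The unit ball is mapped to itself and has positive finite volume, which forces the factor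
  1; no determinant enters.\<close>

lemma distr_lborel_orthogonal_transformation:
  fixes U :: "'a::euclidean_space \<Rightarrow> 'a"
  assumes U: "orthogonal_transformation U"
  shows "distr lborel borel U = lborel"
proof (rule measure_eqI)
  note [measurable] = borel_measurable_orthogonal_transformation[OF U]
  let ?M = "distr lborel borel U"
  let ?B = "ball 0 1 :: 'a set"
  obtain V where V: "orthogonal_transformation V" "\<And>x. V (U x) = x" "\<And>x. U (V x) = x"
    using orthogonal_transformation_inv[OF U] orthogonal_transformation_bij[OF U]
    by (metis bij_inv_eq_iff)
  note [measurable] = borel_measurable_orthogonal_transformation[OF V(1)]
  have lin: "linear U" using U orthogonal_transformation_linear by blast
  have M_B: "emeasure ?M ?B = emeasure lborel ?B"
    by (subst emeasure_distr) (simp_all only: space_lborel Int_UNIV_right vimage_ball_orthogonal_transformation[OF U], measurable)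
  have shift: "(\<integral>\<^sup>+x. f (x + a) \<partial>?M) = (\<integral>\<^sup>+x. f x \<partial>?M)" if [measurable]: "f \<in> borel_measurable borel" for f a
  proof -
    have "(\<integral>\<^sup>+x. f (x + a) \<partial>?M) = (\<integral>\<^sup>+x. f (U (x + V a)) \<partial>lborel)"
      by (simp add: nn_integral_distr linear_add[OF lin] V)
    also have "\<dots> = (\<integral>\<^sup>+x. f x \<partial>?M)"
      by (subst nn_integral_lborel_shift) (auto simp: nn_integral_distr)
    finally show ?thesis .
  qed
  have sf: "sigma_finite_measure ?M"
  proof (rule sigma_finite_measure_distr[where f=V and N=borel])
    have "distr ?M borel V = lborel"
      by (simp add: distr_distr comp_def V distr_id2)
    then show "sigma_finite_measure (distr ?M borel V)"
      by (simp add: sigma_finite_lborel)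
  qed auto
  fix A assume "A \<in> sets ?M"
  then have A: "A \<in> sets borel" by simp
  have "emeasure lborel A * emeasure ?M ?B = emeasure ?M A * emeasure lborel ?B"
    by (rule shift_invariant_proportional[OF _ sf shift A]) auto
  moreover have "emeasure lborel ?B \<noteq> 0" "emeasure lborel ?B \<noteq> \<infinity>"
    using emeasure_lborel_ball_pos[of 1 "0::'a"] emeasure_lborel_ball_finite[of "0::'a" 1]
    by (auto simp: top.not_eq_extremum)
  ultimately show "emeasure ?M A = emeasure lborel A"
    unfolding M_B by (metis ennreal_mult_divide_eq infinity_ennreal_def)
qed simp

section \<open>Cone measure: support, rotation invariance, integrability\<close>

lemma sets_sphere_measure [simp, measurable_cong]: "sets sphere_measure = sets borel"
  by (simp add: sphere_measure_def)

lemma space_sphere_measure [simp]: "space sphere_measure = UNIV"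
  by (simp add: sphere_measure_def)

lemma prob_space_uniform_ball: "prob_space (uniform_measure lborel (ball (0::'a::euclidean_space) 1))"
  using emeasure_lborel_ball_pos[of 1 "0::'a"] emeasure_lborel_ball_finite[of "0::'a" 1]
  by (intro prob_space_uniform_measure) (auto simp: top.not_eq_extremum)

lemma prob_space_sphere_measure: "prob_space (sphere_measure :: 'a::euclidean_space measure)"
  unfolding sphere_measure_def
  by (intro prob_space.prob_space_distr prob_space_uniform_ball) simp

text \<open>Radial projection misses the sphere only at the origin, which it sends to 0 because
  \<open>inverse 0 = 0\<close>; that is a null set.\<close>

lemma AE_sphere_measure_norm: "AE x in (sphere_measure :: 'a::euclidean_space measure). norm x = 1"
proof -
  have "AE x in lborel. x \<noteq> (0::'a)"
    by (rule AE_lborel_singleton)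
  then have "AE x in uniform_measure lborel (ball (0::'a) 1). x \<noteq> 0"
    by (intro AE_uniform_measureI) auto
  then show ?thesis
    unfolding sphere_measure_def by (subst AE_distr_iff) auto
qed

text \<open>\<open>U\<close> preserves the uniform law on the ball and commutes with radial
  projection, so the invariance descends to the image.\<close>

lemma distr_sphere_measure_orthogonal_transformation:
  fixes U :: "'a::euclidean_space \<Rightarrow> 'a"
  assumes U: "orthogonal_transformation U"
  shows "distr sphere_measure borel U = sphere_measure"
proof -
  note [measurable] = borel_measurable_orthogonal_transformation[OF U]
  let ?N = "uniform_measure lborel (ball 0 1 :: 'a set)"
  have N: "distr ?N borel U = ?N"
  proof (rule measure_eqI)
    fix A assume "A \<in> sets (distr ?N borel U)"
    then have [measurable]: "A \<in> sets borel" by simp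
    have [measurable]: "U -` A \<in> sets borel"
      by (rule measurable_sets_borel[of U borel]) simp_all
    have "emeasure lborel (ball 0 1 \<inter> U -` A) = emeasure (distr lborel borel U) (ball 0 1 \<inter> A)"
      by (subst emeasure_distr) (simp_all only: space_lborel Int_UNIV_right vimage_Int vimage_ball_orthogonal_transformation[OF U], measurable)
    then show "emeasure (distr ?N borel U) A = emeasure ?N A"
      by (simp add: emeasure_distr distr_lborel_orthogonal_transformation[OF U])
  qed simp
  have "distr sphere_measure borel U = distr ?N borel (\<lambda>x. U (x /\<^sub>R norm x))"
    unfolding sphere_measure_def by (subst distr_distr) (auto simp: comp_def)
  also have "(\<lambda>x. U (x /\<^sub>R norm x)) = (\<lambda>x. x /\<^sub>R norm x) \<circ> U"
    using U by (auto simp: fun_eq_iff orthogonal_transformation_scaleR orthogonal_transformation_norm)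
  also have "distr ?N borel \<dots> = sphere_measure"
    by (subst distr_distr[where N=borel, symmetric]) (simp_all add: N sphere_measure_def)
  finally show ?thesis .
qed

lemma integral_sphere_measure_orthogonal_transformation:
  fixes U :: "'a::euclidean_space \<Rightarrow> 'a" and f :: "'a \<Rightarrow> real"
  assumes "orthogonal_transformation U" and [measurable]: "f \<in> borel_measurable borel"
  shows "(\<integral>x. f (U x) \<partial>sphere_measure) = (\<integral>x. f x \<partial>sphere_measure)"
  using borel_measurable_orthogonal_transformation[OF assms(1)]
  by (subst (2) distr_sphere_measure_orthogonal_transformation[OF assms(1), symmetric])
     (simp add: integral_distr)

lemma continuous_sphere_bounded:
  fixes f :: "'a::euclidean_space \<Rightarrow> real"
  assumes "continuous_on UNIV f"
  obtains B where "\<And>x. norm x = 1 \<Longrightarrow> \<bar>f x\<bar> \<le> B"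
proof -
  have "bounded (f ` sphere 0 1)"
    by (intro compact_imp_bounded compact_continuous_image continuous_on_subset[OF assms]) auto
  then show thesis
    using that by (auto simp: bounded_iff) (metis mem_sphere_0)
qed

text \<open>The function may be unbounded on the whole space, but the mass sits on the compact
  sphere, where continuity gives a bound.\<close>

lemma integrable_sphere_measure_continuous:
  fixes f :: "'a::euclidean_space \<Rightarrow> real"
  assumes "continuous_on UNIV f"
  shows "integrable sphere_measure f"
proof -
  interpret prob_space "sphere_measure :: 'a measure" by (rule prob_space_sphere_measure)
  have [measurable]: "f \<in> borel_measurable borel"
    by (rule borel_measurable_continuous_onI[OF assms])
  obtain B where "\<And>x. norm x = 1 \<Longrightarrow> \<bar>f x\<bar> \<le> B"
    using continuous_sphere_bounded[OF assms] by blast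
  then show ?thesis
    using AE_sphere_measure_norm
    by (intro integrable_const_bound[where B=B]) (auto elim!: AE_mp)
qed

section \<open>Infinitesimal rotations\<close>

text \<open>For \<open>i = j\<close> only the first branch acts on that coordinate and the map is in
  general not orthogonal, hence the recurring assumption \<open>i \<noteq> j\<close>.\<close>

definition plane_rotation :: "'n \<Rightarrow> 'n \<Rightarrow> real \<Rightarrow> real ^ 'n \<Rightarrow> real ^ 'n" where
  "plane_rotation i j t x = (\<chi> k. if k = i then cos t * x $ i - sin t * x $ j
     else if k = j then sin t * x $ i + cos t * x $ j else x $ k)"

lemma sum_UNIV_remove2:
  fixes f :: "'n::finite \<Rightarrow> 'b::comm_monoid_add"
  assumes "i \<noteq> j"
  shows "(\<Sum>k\<in>UNIV. f k) = f i + (f j + (\<Sum>k\<in>UNIV - {i} - {j}. f k))"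
  using assms by (subst sum.remove[of UNIV i], simp_all) (subst sum.remove[of _ j], simp_all)

lemma orthogonal_transformation_plane_rotation:
  fixes i j :: "'n::finite"
  assumes "i \<noteq> j"
  shows "orthogonal_transformation (plane_rotation i j t)"
proof -
  have "linear (plane_rotation i j t)"
    by (rule linearI) (auto simp: plane_rotation_def vec_eq_iff algebra_simps)
  moreover have "norm (plane_rotation i j t x) = norm x" for x :: "real ^ 'n"
  proof -
    have "(cos t * x $ i - sin t * x $ j)\<^sup>2 + (sin t * x $ i + cos t * x $ j)\<^sup>2
        = ((sin t)\<^sup>2 + (cos t)\<^sup>2) * ((x $ i)\<^sup>2 + (x $ j)\<^sup>2)"
      by algebra
    then have "(cos t * x $ i - sin t * x $ j)\<^sup>2 + (sin t * x $ i + cos t * x $ j)\<^sup>2 = (x $ i)\<^sup>2 + (x $ j)\<^sup>2"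
      by simp
    then have "plane_rotation i j t x \<bullet> plane_rotation i j t x = x \<bullet> x"
      unfolding inner_vec_def sum_UNIV_remove2[OF assms] using assms
      by (auto simp: plane_rotation_def power2_eq_square algebra_simps intro!: sum.cong)
    then show ?thesis by (simp add: norm_eq_sqrt_inner)
  qed
  ultimately show ?thesis by (simp add: orthogonal_transformation)
qed

lemma plane_rotation_0 [simp]: "plane_rotation i j 0 x = x"
  by (auto simp: plane_rotation_def vec_eq_iff)

text \<open>The derivative is written at the rotated point again: the rotations form a flow, so one
  and the same \<open>G\<close> serves at every time \<open>t\<close>, as
  \<open>integral_rotation_derivative_eq_0\<close> requires.\<close>

lemma DERIV_plane_rotation:
  "((\<lambda>t. plane_rotation i j t x $ k) has_real_derivative
     (if k = i then - plane_rotation i j t x $ j else if k = j then plane_rotation i j t x $ i else 0)) (at t)"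
  if "i \<noteq> j"
  using that by (auto simp: plane_rotation_def intro!: derivative_eq_intros)

text \<open>Differentiating \<open>E F(R\<^sub>t X) = E F(X)\<close> at \<open>t = 0\<close>: here \<open>G\<close> is
  \<open>x\<^sub>i \<partial>\<^sub>j F - x\<^sub>j \<partial>\<^sub>i F\<close>, the derivative of \<open>F\<close> along the rotation field.\<close>
lemma integral_rotation_derivative_eq_0:
  fixes i j :: "'n::finite" and F G :: "real ^ 'n \<Rightarrow> real"
  assumes ij: "i \<noteq> j"
    and deriv: "\<And>x t. ((\<lambda>t. F (plane_rotation i j t x)) has_real_derivative G (plane_rotation i j t x)) (at t)"
    and F: "continuous_on UNIV F" and G: "continuous_on UNIV G"
  shows "(\<integral>x. G x \<partial>sphere_measure) = 0"
proof -
  interpret prob_space "sphere_measure :: (real ^ 'n) measure" by (rule prob_space_sphere_measure)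
  note R = orthogonal_transformation_plane_rotation[OF ij]
  note [measurable] = borel_measurable_continuous_onI[OF F] borel_measurable_continuous_onI[OF G]
    borel_measurable_orthogonal_transformation[OF R]
  obtain B where B: "\<And>x. norm x = 1 \<Longrightarrow> \<bar>G x\<bar> \<le> B"
    using continuous_sphere_bounded[OF G] by blast
  \<comment> \<open>Difference quotients with step \<open>1 / Suc k\<close>: invariance gives each
    of them mean 0, and their pointwise limit is \<open>G\<close>.\<close>
  define D where "D k x = real (Suc k) * (F (plane_rotation i j (1 / real (Suc k)) x) - F x)" for k x
  have [measurable]: "D k \<in> borel_measurable borel" for k
    unfolding D_def by measurable
  have D_0: "(\<integral>x. D k x \<partial>sphere_measure) = 0" for k
  proof -
    let ?t = "1 / real (Suc k)"
    have "continuous_on UNIV (\<lambda>x. F (plane_rotation i j ?t x))"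
      using R by (intro continuous_on_compose2[OF F] linear_continuous_on)
        (auto simp: orthogonal_transformation_linear linear_conv_bounded_linear[symmetric])
    then have "integrable sphere_measure (\<lambda>x. F (plane_rotation i j ?t x))"
      by (rule integrable_sphere_measure_continuous)
    then show ?thesis
      unfolding D_def
      by (simp add: integrable_sphere_measure_continuous[OF F]
            integral_sphere_measure_orthogonal_transformation[OF R])
  qed
  have "(\<lambda>k. \<integral>x. D k x \<partial>sphere_measure) \<longlonglongrightarrow> (\<integral>x. G x \<partial>sphere_measure)"
  proof (rule integral_dominated_convergence[where w="\<lambda>_. B"])
    have "(\<lambda>k. D k x) \<longlonglongrightarrow> G x" for x
    proof -
      have "((\<lambda>h. (F (plane_rotation i j h x) - F x) / h) \<longlongrightarrow> G x) (at 0)"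
        using deriv[of x 0] by (simp add: DERIV_def)
      then have "(\<lambda>k. (F (plane_rotation i j (1 / real (Suc k)) x) - F x) / (1 / real (Suc k))) \<longlonglongrightarrow> G x"
        by (rule filterlim_compose)
           (auto simp: filterlim_at simp del: of_nat_Suc intro!: always_eventually lim_1_over_n LIMSEQ_Suc)
      then show ?thesis by (simp add: D_def mult.commute)
    qed
    then show "AE x in sphere_measure. (\<lambda>k. D k x) \<longlonglongrightarrow> G x" by simp
    \<comment> \<open>By the mean value theorem the quotient is a value of \<open>G\<close> at
      another point of the sphere, so one bound \<open>B\<close> dominates for all
      \<open>k\<close>.\<close>
    have "\<bar>D k x\<bar> \<le> B" if "norm x = 1" for k x
    proof -
      let ?t = "1 / real (Suc k)"
      have "\<exists>z. 0 < z \<and> z < ?t \<and>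
         F (plane_rotation i j ?t x) - F (plane_rotation i j 0 x) = (?t - 0) * G (plane_rotation i j z x)"
        using deriv by (intro MVT2) auto
      then obtain z where "F (plane_rotation i j ?t x) - F x = ?t * G (plane_rotation i j z x)"
        by auto
      then have "D k x = G (plane_rotation i j z x)" by (simp add: D_def)
      moreover have "norm (plane_rotation i j z x) = 1"
        using that by (simp add: orthogonal_transformation_norm[OF R])
      ultimately show ?thesis using B by simp
    qed
    then show "AE x in sphere_measure. norm (D k x) \<le> B" for k
      using AE_sphere_measure_norm by (auto elim!: AE_mp)
  qed auto
  then show ?thesis by (simp add: D_0 LIMSEQ_const_iff)
qed

section \<open>Second and fourth moments of the coordinates\<close>

lemma sum_squares_eq_norm: "(\<Sum>k\<in>UNIV. (x $ k)\<^sup>2) = (norm (x::real^'n))\<^sup>2"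
  by (simp add: norm_vec_def L2_set_def sum_nonneg)

lemma integral_sphere_measure_cong:
  fixes f g :: "'a::euclidean_space \<Rightarrow> real"
  assumes "continuous_on UNIV f" "continuous_on UNIV g" "\<And>x. norm x = 1 \<Longrightarrow> f x = g x"
  shows "(\<integral>x. f x \<partial>sphere_measure) = (\<integral>x. g x \<partial>sphere_measure)"
proof (rule integral_cong_AE)
  show "AE x in sphere_measure. f x = g x"
    using AE_sphere_measure_norm by (rule AE_mp) (simp add: assms(3))
qed (intro borel_measurable_integrable integrable_sphere_measure_continuous assms)+

text \<open>Differentiating \<open>x $ k * x $ i\<close> along the rotation equates the moments of
  the two coordinates; all of them add up to 1 because the norm is 1.\<close>

lemma sphere_second_moment:
  "(\<integral>x. (x $ i)\<^sup>2 \<partial>(sphere_measure :: (real ^ 'n) measure)) = 1 / real CARD('n)"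
proof -
  interpret prob_space "sphere_measure :: (real ^ 'n) measure" by (rule prob_space_sphere_measure)
  let ?E = "\<lambda>k. \<integral>x. (x $ k)\<^sup>2 \<partial>(sphere_measure :: (real ^ 'n) measure)"
  have int: "integrable sphere_measure (\<lambda>x::real^'n. (x $ k)\<^sup>2)" for k
    by (intro integrable_sphere_measure_continuous continuous_intros)
  have eq: "?E k = ?E i" for k
  proof (cases "k = i")
    case False
    have "(\<integral>x. (x $ k)\<^sup>2 - (x $ i)\<^sup>2 \<partial>(sphere_measure :: (real ^ 'n) measure)) = 0"
      using False
      by (intro integral_rotation_derivative_eq_0[where i=k and j=i and F="\<lambda>x. x $ k * x $ i"])
         (auto intro!: derivative_eq_intros DERIV_plane_rotation continuous_intros simp: power2_eq_square)
    then show ?thesis by (simp add: int)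
  qed auto
  have "real CARD('n) * ?E i = (\<Sum>k\<in>UNIV. ?E k)"
    using sum.cong[of UNIV UNIV ?E "\<lambda>_. ?E i"] eq by simp
  also have "\<dots> = (\<integral>x. (\<Sum>k\<in>UNIV. (x $ k)\<^sup>2) \<partial>(sphere_measure :: (real ^ 'n) measure))"
    by (simp add: int)
  also have "\<dots> = (\<integral>x. 1 \<partial>(sphere_measure :: (real ^ 'n) measure))"
    by (intro integral_sphere_measure_cong continuous_intros) (simp add: sum_squares_eq_norm)
  also have "\<dots> = 1" using prob_space by simp
  finally show ?thesis by (simp add: field_simps)
qed

text \<open>Differentiating x_k^3 x_l along the rotation gives E x_k^4 = 3 E x_k^2 x_l^2. Inserting
  the factor sum_l x_l^2 = 1 into the second moment then yields 1/n = E x_k^4 (n + 2) / 3.\<close>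

lemma sphere_fourth_moment:
  "(\<integral>x. (x $ i)\<^sup>2 * (x $ j)\<^sup>2 \<partial>(sphere_measure :: (real ^ 'n) measure))
     = (if i = j then 3 else 1) / (real CARD('n) * (real CARD('n) + 2))"
proof -
  interpret prob_space "sphere_measure :: (real ^ 'n) measure" by (rule prob_space_sphere_measure)
  let ?n = "real CARD('n)"
  let ?E = "\<lambda>k l. \<integral>x. (x $ k)\<^sup>2 * (x $ l)\<^sup>2 \<partial>(sphere_measure :: (real ^ 'n) measure)"
  have int: "integrable sphere_measure (\<lambda>x::real^'n. (x $ k)\<^sup>2 * (x $ l)\<^sup>2)" for k l
    by (intro integrable_sphere_measure_continuous continuous_intros)
  have eq: "?E k l = ?E k k / 3" if "l \<noteq> k" for k l
  proof -
    have "(\<integral>x. (x $ k)\<^sup>2 * (x $ k)\<^sup>2 - 3 * ((x $ k)\<^sup>2 * (x $ l)\<^sup>2) \<partial>(sphere_measure :: (real ^ 'n) measure)) = 0"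
      using that
      by (intro integral_rotation_derivative_eq_0[where i=k and j=l and F="\<lambda>x. (x $ k) ^ 3 * x $ l"])
         (auto intro!: derivative_eq_intros DERIV_plane_rotation continuous_intros
           simp: power2_eq_square power3_eq_cube)
    then show ?thesis using int[of k k] int[of k l] by simp
  qed
  have diag: "?E k k = 3 / (?n * (?n + 2))" for k
  proof -
    have "(\<integral>x. (x $ k)\<^sup>2 \<partial>(sphere_measure :: (real ^ 'n) measure))
        = (\<integral>x. (\<Sum>l\<in>UNIV. (x $ k)\<^sup>2 * (x $ l)\<^sup>2) \<partial>(sphere_measure :: (real ^ 'n) measure))"
      by (intro integral_sphere_measure_cong continuous_intros)
         (simp add: sum_squares_eq_norm flip: sum_distrib_left)
    also have "\<dots> = (\<Sum>l\<in>UNIV. ?E k l)"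
      by (simp add: int)
    also have "\<dots> = ?E k k + (\<Sum>l\<in>UNIV - {k}. ?E k k / 3)"
      by (subst sum.remove[of _ k]) (auto simp: eq intro!: sum.cong)
    also have "\<dots> = ?E k k * (?n + 2) / 3"
      by (simp add: card_Diff_singleton of_nat_diff field_simps)
    finally have "?E k k * (?n * (?n + 2)) = 3"
      by (simp add: sphere_second_moment field_simps)
    moreover have "?n * (?n + 2) \<noteq> 0"
      using zero_less_card_finite[where 'a='n] by (simp add: add_nonneg_eq_0_iff)
    ultimately show ?thesis by (subst nonzero_eq_divide_eq)
  qed
  show ?thesis
  proof (cases "i = j")
    case False
    then show ?thesis using eq[of j i] diag[of i] by simp
  qed (use diag in simp)
qed

section \<open>Integration by parts for diagonal forms\<close>

lemma DERIV_diag_form_plane_rotation: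
  fixes e :: "real ^ 'n"
  assumes "i \<noteq> j"
  shows "((\<lambda>t. \<Sum>k\<in>UNIV. e $ k * (plane_rotation i j t x $ k)\<^sup>2) has_real_derivative
     2 * (e $ j - e $ i) * plane_rotation i j t x $ i * plane_rotation i j t x $ j) (at t)"
proof -
  let ?y = "plane_rotation i j t x"
  have "((\<lambda>t. \<Sum>k\<in>UNIV. e $ k * (plane_rotation i j t x $ k)\<^sup>2) has_real_derivative
     (\<Sum>k\<in>UNIV. e $ k * (2 * ?y $ k * (if k = i then - ?y $ j else if k = j then ?y $ i else 0)))) (at t)"
    by (auto intro!: derivative_eq_intros DERIV_plane_rotation[OF assms] sum.cong simp: algebra_simps)
  also have "(\<Sum>k\<in>UNIV. e $ k * (2 * ?y $ k * (if k = i then - ?y $ j else if k = j then ?y $ i else 0)))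
     = 2 * (e $ j - e $ i) * ?y $ i * ?y $ j"
    unfolding sum_UNIV_remove2[OF assms] using assms by (simp add: algebra_simps)
  finally show ?thesis .
qed

text \<open>The rotation fields satisfy \<open>\<Sum>\<^sub>i\<^sub>,\<^sub>j D\<^sub>i\<^sub>j\<^sup>2 = 2 \<Delta>\<close> on the sphere, so summing the
  rotation identity for \<open>h(W) D\<^sub>i\<^sub>j W\<close> is integration by parts against the Laplacian, of which
  the trace-free form is an eigenfunction.\<close>
lemma sphere_quadratic_stein_identity:
  fixes e :: "real ^ 'n" and h h' :: "real \<Rightarrow> real" and C :: real
  assumes tr: "(\<Sum>k\<in>UNIV. e $ k) = 0"
    and h: "\<And>w. (h has_real_derivative h' w) (at w)" and h': "continuous_on UNIV h'"
  defines "W \<equiv> \<lambda>x::real^'n. C * (\<Sum>k\<in>UNIV. e $ k * (x $ k)\<^sup>2)"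
  shows "(\<integral>x. W x * h (W x) \<partial>sphere_measure) = 2 * C\<^sup>2 / real CARD('n) *
    (\<integral>x. h' (W x) * ((\<Sum>k\<in>UNIV. (e $ k)\<^sup>2 * (x $ k)\<^sup>2) - (\<Sum>k\<in>UNIV. e $ k * (x $ k)\<^sup>2)\<^sup>2) \<partial>sphere_measure)"
proof -
  let ?n = "real CARD('n)" and ?S = "sphere_measure :: (real^'n) measure"
  define g where "g x = (\<Sum>k\<in>UNIV. e $ k * (x $ k)\<^sup>2)" for x
  define Q where "Q x = (\<Sum>k\<in>UNIV. (e $ k)\<^sup>2 * (x $ k)\<^sup>2)" for x
  have W: "W = (\<lambda>x. C * g x)" by (simp add: W_def g_def)
  have cont_g: "continuous_on UNIV g" "continuous_on UNIV W" "continuous_on UNIV Q"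
    unfolding g_def W_def Q_def by (intro continuous_intros)+
  have "continuous_on UNIV h"
    using h by (intro DERIV_continuous_on) auto
  then have cont: "continuous_on UNIV (\<lambda>x. h (W x))" "continuous_on UNIV (\<lambda>x. h' (W x))"
    using h' cont_g by (auto intro: continuous_on_compose2)
  note cont = cont cont_g
  \<comment> \<open>The function being rotated is \<open>h (W x)\<close> times the rotation
    derivative of \<open>W\<close> stripped of its factor \<open>2 * C\<close>; leaving that factor
    out avoids a division by \<open>C\<close>, which may be 0.\<close>
  define G where "G i j x = (e $ j - e $ i) * ((x $ i)\<^sup>2 - (x $ j)\<^sup>2) * h (W x)
      + 2 * C * (e $ j - e $ i)\<^sup>2 * (x $ i)\<^sup>2 * (x $ j)\<^sup>2 * h' (W x)" for i j x
  have cont_G: "continuous_on UNIV (G i j)" for i j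
    unfolding G_def by (intro continuous_intros cont)
  have "(\<integral>x. G i j x \<partial>?S) = 0" for i j
  proof (cases "i = j")
    case False
    have "((\<lambda>t. W (plane_rotation i j t x)) has_real_derivative
        C * (2 * (e $ j - e $ i) * plane_rotation i j t x $ i * plane_rotation i j t x $ j)) (at t)" for x t
      unfolding W_def using False by (intro DERIV_cmult DERIV_diag_form_plane_rotation)
    note dW = DERIV_chain2[OF h this]
    show ?thesis
      using False
      by (intro integral_rotation_derivative_eq_0[where i=i and j=j
            and F="\<lambda>x. (e $ j - e $ i) * x $ i * x $ j * h (W x)"] cont_G continuous_intros cont)
         (auto intro!: derivative_eq_intros DERIV_plane_rotation dW
           simp: G_def power2_eq_square algebra_simps)
  qed (simp add: G_def)
  then have "0 = (\<Sum>i\<in>UNIV. \<Sum>j\<in>UNIV. \<integral>x. G i j x \<partial>?S)"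
    by simp
  also have "\<dots> = (\<integral>x. (\<Sum>i\<in>UNIV. \<Sum>j\<in>UNIV. G i j x) \<partial>?S)"
    using integrable_sphere_measure_continuous[OF cont_G] by simp
  also have "\<dots> = (\<integral>x. 4 * C * (h' (W x) * (Q x - (g x)\<^sup>2)) - 2 * ?n * (g x * h (W x)) \<partial>?S)"
  proof (rule integral_sphere_measure_cong)
    fix x :: "real^'n" assume "norm x = 1"
    then have x: "(\<Sum>i\<in>UNIV. (x $ i)\<^sup>2) = 1" by (simp add: sum_squares_eq_norm)
    \<comment> \<open>This is the spherical Laplacian of \<open>g\<close>. The mixed sums contain
      the trace as a factor and vanish; the other two contribute \<open>- ?n * g x\<close> each,
      hence the eigenvalue.\<close>
    have "(\<Sum>i\<in>UNIV. \<Sum>j\<in>UNIV. (e $ j - e $ i) * ((x $ i)\<^sup>2 - (x $ j)\<^sup>2))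
       = (\<Sum>i\<in>UNIV. \<Sum>j\<in>UNIV. (x $ i)\<^sup>2 * e $ j) + (\<Sum>i\<in>UNIV. \<Sum>j\<in>UNIV. e $ i * (x $ j)\<^sup>2)
        - (\<Sum>i\<in>UNIV. \<Sum>j\<in>(UNIV::'n set). e $ i * (x $ i)\<^sup>2) - (\<Sum>i\<in>(UNIV::'n set). \<Sum>j\<in>UNIV. e $ j * (x $ j)\<^sup>2)"
      by (simp only: sum.distrib[symmetric] sum_subtractf[symmetric]) (simp add: algebra_simps)
    also have "\<dots> = - 2 * ?n * g x"
      unfolding sum_product[symmetric] tr by (simp add: g_def sum_distrib_left mult.assoc)
    finally have 1: "(\<Sum>i\<in>UNIV. \<Sum>j\<in>UNIV. (e $ j - e $ i) * ((x $ i)\<^sup>2 - (x $ j)\<^sup>2)) = - 2 * ?n * g x" .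
    \<comment> \<open>Half of this double sum is the variance of the entries of \<open>e\<close>
      under the probability weights \<open>(x $ k)\<^sup>2\<close>.\<close>
    have "(\<Sum>i\<in>UNIV. \<Sum>j\<in>UNIV. (e $ j - e $ i)\<^sup>2 * (x $ i)\<^sup>2 * (x $ j)\<^sup>2)
       = (\<Sum>i\<in>UNIV. \<Sum>j\<in>UNIV. (x $ i)\<^sup>2 * ((e $ j)\<^sup>2 * (x $ j)\<^sup>2))
         + (\<Sum>i\<in>UNIV. \<Sum>j\<in>UNIV. ((e $ i)\<^sup>2 * (x $ i)\<^sup>2) * (x $ j)\<^sup>2)
         - 2 * (\<Sum>i\<in>UNIV. \<Sum>j\<in>UNIV. (e $ i * (x $ i)\<^sup>2) * (e $ j * (x $ j)\<^sup>2))"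
      unfolding sum_distrib_left sum.distrib[symmetric] sum_subtractf[symmetric]
      by (simp add: power2_eq_square algebra_simps)
    also have "\<dots> = 2 * (Q x - (g x)\<^sup>2)"
      unfolding sum_product[symmetric] x by (simp add: Q_def g_def power2_eq_square)
    finally have 2: "(\<Sum>i\<in>UNIV. \<Sum>j\<in>UNIV. (e $ j - e $ i)\<^sup>2 * (x $ i)\<^sup>2 * (x $ j)\<^sup>2) = 2 * (Q x - (g x)\<^sup>2)" .
    have "(\<Sum>i\<in>UNIV. \<Sum>j\<in>UNIV. G i j x)
       = (\<Sum>i\<in>UNIV. \<Sum>j\<in>UNIV. (e $ j - e $ i) * ((x $ i)\<^sup>2 - (x $ j)\<^sup>2)) * h (W x)
         + 2 * C * (\<Sum>i\<in>UNIV. \<Sum>j\<in>UNIV. (e $ j - e $ i)\<^sup>2 * (x $ i)\<^sup>2 * (x $ j)\<^sup>2) * h' (W x)"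
      unfolding G_def sum_distrib_left sum_distrib_right sum.distrib[symmetric]
      by (simp add: mult.assoc)
    then show "(\<Sum>i\<in>UNIV. \<Sum>j\<in>UNIV. G i j x) = 4 * C * (h' (W x) * (Q x - (g x)\<^sup>2)) - 2 * ?n * (g x * h (W x))"
      unfolding 1 2 by (simp add: algebra_simps)
  qed (intro continuous_intros cont cont_G)+
  also have "\<dots> = 4 * C * (\<integral>x. h' (W x) * (Q x - (g x)\<^sup>2) \<partial>?S) - 2 * ?n * (\<integral>x. g x * h (W x) \<partial>?S)"
    by (subst Bochner_Integration.integral_diff)
       (auto intro!: integrable_sphere_measure_continuous continuous_intros cont)
  finally have "(\<integral>x. g x * h (W x) \<partial>?S) = 2 * C / ?n * (\<integral>x. h' (W x) * (Q x - (g x)\<^sup>2) \<partial>?S)"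
    by (simp add: field_simps)
  moreover have "(\<integral>x. W x * h (W x) \<partial>?S) = C * (\<integral>x. g x * h (W x) \<partial>?S)"
    by (simp add: W mult.assoc)
  ultimately show ?thesis
    by (simp add: Q_def g_def power2_eq_square)
qed

section \<open>The Stein equation\<close>

text \<open>The part of the integral below \<open>w - 1\<close> is a constant, and on the compact
  rest the fundamental theorem of calculus applies.\<close>

lemma DERIV_integral_atMost:
  fixes f :: "real \<Rightarrow> real"
  assumes int: "integrable lborel f" and cont: "continuous_on UNIV f"
  shows "((\<lambda>w. \<integral>x. f x * indicator {..w} x \<partial>lborel) has_real_derivative f w) (at w)"
proof -
  let ?a = "w - 1" and ?b = "w + 1"
  have eq: "(\<integral>x. f x * indicator {..v} x \<partial>lborel)
      = (\<integral>x. f x * indicator {..<?a} x \<partial>lborel) + integral {?a..v} f" if "v \<in> {?a<..<?b}" for v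
  proof -
    have set_int: "set_integrable lborel A f" if "A \<in> sets borel" for A
      unfolding set_integrable_def using int that by (intro integrable_mult_indicator) simp_all
    have "(LINT x:({..<?a} \<union> {?a..v})|lborel. f x) = (LINT x:{..<?a}|lborel. f x) + (LINT x:{?a..v}|lborel. f x)"
      by (intro set_integral_Un set_int) auto
    moreover have "{..<?a} \<union> {?a..v} = {..v}" using that by auto
    ultimately show ?thesis
      using set_borel_integral_eq_integral(2)[OF set_int, of "{?a..v}"]
      by (simp add: set_lebesgue_integral_def mult.commute)
  qed
  have "((\<lambda>v. integral {?a..v} f) has_real_derivative f w) (at w within {?a..?b})"
    by (intro integral_has_real_derivative continuous_on_subset[OF cont]) auto
  then have "((\<lambda>v. (\<integral>x. f x * indicator {..<?a} x \<partial>lborel) + integral {?a..v} f) has_real_derivative f w) (at w)"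
    by (auto intro!: derivative_eq_intros simp: at_within_Icc_at)
  then show ?thesis
    by (rule has_field_derivative_transform_within_open[where S="{?a<..<?b}"]) (use eq in auto)
qed

section \<open>Truncated Gaussian moments\<close>

lemma DERIV_std_normal_density:
  "(std_normal_density has_real_derivative - w * std_normal_density w) (at w)"
proof -
  have "((\<lambda>x. exp (- x\<^sup>2 / 2)) has_real_derivative exp (- w\<^sup>2 / 2) * - w) (at w)"
    by (auto intro!: derivative_eq_intros)
  from DERIV_cmult[OF this, of "1 / sqrt (2 * pi)"] show ?thesis
    unfolding std_normal_density_def by (simp add: mult_ac)
qed

lemma continuous_std_normal_density: "continuous_on UNIV std_normal_density"
  using DERIV_std_normal_density by (intro DERIV_continuous_on) auto

lemma integrable_std_normal_density_mult:
  assumes "u \<in> borel_measurable borel" and "\<And>x. \<bar>u x\<bar> \<le> B"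
  shows "integrable lborel (\<lambda>x. u x * std_normal_density x)"
  using assms
  by (intro Bochner_Integration.integrable_bound[where f="\<lambda>x. B * std_normal_density x" and g="\<lambda>x. u x * std_normal_density x"])
     (auto simp: abs_mult intro!: mult_right_mono order_trans[OF _ abs_ge_self])

text \<open>Adding the density gives a function with derivative 0, which tends to 0 at infinity
  because the full first moment vanishes.\<close>

lemma integral_atMost_std_normal_first_moment:
  "(\<integral>x. (x * std_normal_density x) * indicator {..w} x \<partial>lborel) = - std_normal_density w"
proof -
  let ?f = "\<lambda>x. x * std_normal_density x"
  have int: "integrable lborel ?f"
    using integrable_std_normal_moment[of 1] by (simp add: mult.commute)
  have int0: "(\<integral>x. ?f x \<partial>lborel) = 0"
    using integral_std_normal_moment_odd[of 0] by (simp add: mult.commute)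
  define D where "D w = (\<integral>x. ?f x * indicator {..w} x \<partial>lborel) + std_normal_density w" for w
  have "(D has_real_derivative 0) (at w)" for w
    unfolding D_def
    by (rule derivative_eq_intros DERIV_integral_atMost int DERIV_std_normal_density
        continuous_intros continuous_std_normal_density | simp)+
  then have const: "D w = D 0" for w
    by (intro DERIV_isconst_all) auto
  have "(std_normal_density \<longlongrightarrow> 0) at_top"
    unfolding std_normal_density_def by real_asymp
  moreover have "((\<lambda>w. \<integral>x. indicator {..w} x *\<^sub>R ?f x \<partial>lborel) \<longlongrightarrow> (\<integral>x. ?f x \<partial>lborel)) at_top"
    by (rule tendsto_integral_at_top[OF _ int]) simp
  ultimately have "(D \<longlongrightarrow> 0) at_top"
    unfolding D_def using tendsto_add int0 by (force simp: mult.commute)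
  moreover have "(D \<longlongrightarrow> D 0) at_top"
    by (rule tendsto_eventually) (intro always_eventually allI const)
  ultimately have "D 0 = 0"
    by (intro tendsto_unique[of at_top D]) auto
  then show ?thesis using const[of w] by (simp add: D_def)
qed

definition std_normal_cdf :: "real \<Rightarrow> real" where
  "std_normal_cdf w = (\<integral>x. std_normal_density x * indicator {..w} x \<partial>lborel)"

lemma integrable_mult_indicator_right:
  fixes f :: "'a \<Rightarrow> real"
  assumes "integrable M f" "A \<in> sets M"
  shows "integrable M (\<lambda>x. f x * indicator A x)"
  using integrable_mult_indicator[OF assms(2,1)] by (simp add: mult.commute)

text \<open>The two quantities are the Gaussian integrals of \<open>w - x\<close> over
  \<open>x \<le> w\<close> and of \<open>x - w\<close> over \<open>x > w\<close>. In this
  division-free form Mills' inequality covers both signs of \<open>w\<close>.\<close>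

lemma mills_ratio_bounds:
  shows "0 \<le> std_normal_density w + w * std_normal_cdf w"
    and "0 \<le> std_normal_density w - w * (1 - std_normal_cdf w)"
proof -
  have int: "integrable lborel std_normal_density" "integrable lborel (\<lambda>x. x * std_normal_density x)"
    using integrable_std_normal_moment[of 0] integrable_std_normal_moment[of 1] by (simp_all add: mult.commute)
  have int0: "(\<integral>x. x * std_normal_density x \<partial>lborel) = 0" "(\<integral>x. std_normal_density x \<partial>lborel) = 1"
    using integral_std_normal_moment_odd[of 0] integral_std_normal_moment_even[of 0] by (simp_all add: mult.commute)
  note int' = int[THEN integrable_mult_indicator_right, of "{..w}"]
  let ?I = "\<integral>x. w * (std_normal_density x * indicator {..w} x) - x * std_normal_density x * indicator {..w} x \<partial>lborel"
  have "0 \<le> ?I"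
    by (intro Bochner_Integration.integral_nonneg)
       (auto simp: indicator_def algebra_simps intro!: mult_right_mono)
  also have I: "?I = w * std_normal_cdf w + std_normal_density w"
    using int' by (simp add: std_normal_cdf_def integral_atMost_std_normal_first_moment)
  finally show "0 \<le> std_normal_density w + w * std_normal_cdf w" by simp
  have "0 \<le> (\<integral>x. (x * std_normal_density x - w * std_normal_density x) +
      (w * (std_normal_density x * indicator {..w} x) - x * std_normal_density x * indicator {..w} x) \<partial>lborel)"
    by (intro Bochner_Integration.integral_nonneg)
       (auto simp: indicator_def algebra_simps intro!: mult_right_mono)
  also have "\<dots> = (\<integral>x. x * std_normal_density x - w * std_normal_density x \<partial>lborel) + ?I"
    using int int' by (intro Bochner_Integration.integral_add) auto
  also have "\<dots> = - w + ?I"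
    using int by (simp add: int0)
  finally show "0 \<le> std_normal_density w - w * (1 - std_normal_cdf w)"
    unfolding I by (simp add: algebra_simps)
qed

text \<open>The constant \<open>1\<close>: \<open>h' w\<close> is \<open>u w\<close> minus the Gaussian mean of \<open>u\<close> reweighted by constants \<open>a\<close> on
  \<open>{..w}\<close> and \<open>b\<close> on \<open>{w<..}\<close>, which are nonnegative by Mills' inequality and have total mass \<open>1\<close>.\<close>
lemma gaussian_stein_solution:
  fixes u :: "real \<Rightarrow> real"
  assumes cont: "continuous_on UNIV u" and u: "\<And>x. 0 \<le> u x" "\<And>x. u x \<le> 1"
  obtains h h' where "\<And>w. (h has_real_derivative h' w) (at w)" "continuous_on UNIV h'"
    "\<And>w. \<bar>h' w\<bar> \<le> 1" "\<And>w. h' w - w * h w = u w - (\<integral>x. u x \<partial>std_gaussian)"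
proof -
  let ?p = std_normal_density and ?c = std_normal_cdf
  have [measurable]: "u \<in> borel_measurable borel"
    by (rule borel_measurable_continuous_onI[OF cont])
  have int: "integrable lborel (\<lambda>x. u x * ?p x)" "integrable lborel ?p"
    using integrable_std_normal_density_mult[of u 1] integrable_std_normal_moment[of 0] u by auto
  define m where "m = (\<integral>x. u x * ?p x \<partial>lborel)"
  have m: "(\<integral>x. u x \<partial>std_gaussian) = m"
    unfolding std_gaussian_def m_def by (subst integral_density) (auto simp: mult.commute)
  define L where "L w = (\<integral>x. u x * ?p x * indicator {..w} x \<partial>lborel)" for w
  \<comment> \<open>Integrating factor solution: the integral of \<open>(u x - m) * ?p x\<close> up
    to \<open>w\<close>, divided by \<open>?p w\<close>. The Stein equation then serves as the
    definition of \<open>h'\<close>, and what remains is that \<open>h'\<close> is the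
    derivative.\<close>
  define h where "h w = (L w - m * ?c w) / ?p w" for w
  define h' where "h' w = u w - m + w * h w" for w
  have p_pos: "?p w > 0" for w by (simp add: normal_density_pos)
  have dL: "(L has_real_derivative u w * ?p w) (at w)" for w
    unfolding L_def by (intro DERIV_integral_atMost int continuous_intros cont continuous_std_normal_density)
  have dc: "(?c has_real_derivative ?p w) (at w)" for w
    unfolding std_normal_cdf_def[abs_def] by (intro DERIV_integral_atMost int continuous_std_normal_density)
  have dh: "(h has_real_derivative h' w) (at w)" for w
  proof -
    have "(h has_real_derivative ((u w * ?p w - m * ?p w) * ?p w - (L w - m * ?c w) * (- w * ?p w)) / (?p w * ?p w)) (at w)"
      unfolding h_def using p_pos[of w]
      by (intro DERIV_divide DERIV_diff DERIV_cmult dL dc DERIV_std_normal_density) simp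
    also have "((u w * ?p w - m * ?p w) * ?p w - (L w - m * ?c w) * (- w * ?p w)) / (?p w * ?p w) = h' w"
      using p_pos[of w] by (simp add: h'_def h_def field_simps)
    finally show ?thesis .
  qed
  have "continuous_on UNIV h" using dh by (intro DERIV_continuous_on) auto
  then have "continuous_on UNIV h'" unfolding h'_def by (intro continuous_intros cont)
  moreover have "\<bar>h' w\<bar> \<le> 1" for w
  proof -
    \<comment> \<open>\<open>R\<close> is the part of \<open>m\<close> above \<open>w\<close>. Then
      \<open>L w - m * ?c w\<close> equals \<open>L w * (1 - ?c w) - R * ?c w\<close>, and
      collecting the coefficients of \<open>L w\<close> and \<open>R\<close> in \<open>h' w\<close>
      produces \<open>a\<close> and \<open>b\<close>.\<close>
    define R where "R = (\<integral>x. u x * ?p x - u x * ?p x * indicator {..w} x \<partial>lborel)"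
    define a where "a = 1 - w * (1 - ?c w) / ?p w"
    define b where "b = 1 + w * ?c w / ?p w"
    note int' = int[THEN integrable_mult_indicator_right, of "{..w}"]
    have mLR: "m = L w + R"
      unfolding m_def L_def R_def using int int' by simp
    have "0 \<le> L w" "0 \<le> R"
      unfolding L_def R_def by (intro Bochner_Integration.integral_nonneg; auto simp: indicator_def u)+
    moreover have "L w \<le> ?c w"
      unfolding L_def std_normal_cdf_def using int int'
      by (intro integral_mono) (auto simp: indicator_def u intro!: mult_left_le_one_le)
    moreover have "R \<le> 1 - ?c w"
    proof -
      have "R \<le> (\<integral>x. ?p x - ?p x * indicator {..w} x \<partial>lborel)"
        unfolding R_def using int int'
        by (intro integral_mono) (auto simp: indicator_def u intro!: mult_left_le_one_le)
      also have "\<dots> = 1 - ?c w"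
        using int int' integral_std_normal_moment_even[of 0] by (simp add: std_normal_cdf_def)
      finally show ?thesis .
    qed
    moreover have "0 \<le> a" "0 \<le> b"
      using mills_ratio_bounds[of w] p_pos[of w] by (auto simp: a_def b_def field_simps)
    ultimately have "0 \<le> L w * a + R * b" "L w * a + R * b \<le> ?c w * a + (1 - ?c w) * b"
      by (auto intro!: add_mono mult_right_mono)
    moreover have "?c w * a + (1 - ?c w) * b = 1"
      using p_pos[of w] by (simp add: a_def b_def field_simps)
    moreover have "h' w = u w - (L w * a + R * b)"
      using p_pos[of w] by (simp add: h'_def h_def a_def b_def mLR field_simps)
    ultimately show ?thesis using u[of w] by auto
  qed
  ultimately show thesis
    using that[of h h'] dh by (auto simp: m h'_def)
qed

section \<open>Total variation and continuous test functions\<close>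

text \<open>The tent functions \<open>u k\<close> decrease to the indicator of \<open>K\<close>,
  since points off a closed set have positive distance from it. The empty set is excluded because
  \<open>infdist x {}\<close> is 0, which would make every \<open>u k\<close> constantly 1.\<close>

lemma measure_closed_diff_le:
  fixes M N :: "'a::metric_space measure"
  assumes M: "prob_space M" "sets M = sets borel" and N: "prob_space N" "sets N = sets borel"
    and le: "\<And>u. continuous_on UNIV u \<Longrightarrow> (\<And>x. 0 \<le> u x) \<Longrightarrow> (\<And>x. u x \<le> 1) \<Longrightarrow>
        (\<integral>x. u x \<partial>M) - (\<integral>x. u x \<partial>N) \<le> (b::real)"
    and K: "closed K" "K \<noteq> {}"
  shows "measure M K - measure N K \<le> b"
proof -
  define u where "u k x = max 0 (1 - real k * infdist x K)" for k :: nat and x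
  have cont: "continuous_on UNIV (u k)" for k
    unfolding u_def by (intro continuous_intros)
  have bounds: "0 \<le> u k x" "u k x \<le> 1" for k x
    by (auto simp: u_def infdist_nonneg)
  have lim: "(\<lambda>k. u k x) \<longlonglongrightarrow> indicator K x" for x
  proof (cases "x \<in> K")
    case True
    then show ?thesis by (simp add: u_def)
  next
    case False
    then have pos: "infdist x K > 0"
      using K in_closed_iff_infdist_zero[of K x] infdist_nonneg[of x K] by fastforce
    then obtain k0 :: nat where "1 / infdist x K < real k0"
      using reals_Archimedean2 by blast
    then have "u k x = 0" if "k \<ge> k0" for k
    proof -
      have "1 < real k0 * infdist x K"
        using \<open>1 / infdist x K < real k0\<close> pos by (simp add: field_simps)
      also have "\<dots> \<le> real k * infdist x K"
        using that pos by (intro mult_right_mono) auto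
      finally show ?thesis by (simp add: u_def)
    qed
    then show ?thesis
      using False by (intro tendsto_eventually) (auto simp: eventually_sequentially)
  qed
  have "(\<lambda>k. \<integral>x. u k x \<partial>P) \<longlonglongrightarrow> measure P K" if P: "prob_space P" "sets P = sets borel" for P
  proof -
    interpret prob_space P by fact
    note [measurable_cong] = P(2)
    have [measurable]: "u k \<in> borel_measurable borel" for k
      by (rule borel_measurable_continuous_onI[OF cont])
    have [measurable]: "K \<in> sets borel" using K by simp
    have "(\<lambda>k. \<integral>x. u k x \<partial>P) \<longlonglongrightarrow> (\<integral>x. indicator K x \<partial>P)"
      by (rule integral_dominated_convergence[where w="\<lambda>_. 1"]) (auto simp: lim bounds)
    then show ?thesis
      using P(2) by (simp add: sets_eq_imp_space_eq)
  qed
  from tendsto_diff[OF this[OF M] this[OF N]] show ?thesis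
    by (rule LIMSEQ_le_const2) (use le[OF cont bounds] in auto)
qed

text \<open>Inner regularity of \<open>M\<close> replaces a Borel set by a compact subset, which can
  only lower the \<open>N\<close>-measure; this settles one sign, and complements supply the
  other.\<close>

lemma d_TV_le_continuous_test_functions:
  assumes M: "prob_space M" "sets M = sets borel" and N: "prob_space N" "sets N = sets borel"
    and le: "\<And>u. continuous_on UNIV u \<Longrightarrow> (\<And>x. 0 \<le> u x) \<Longrightarrow> (\<And>x. u x \<le> 1) \<Longrightarrow>
        (\<integral>x. u x \<partial>M) - (\<integral>x. u x \<partial>N) \<le> b"
  shows "d_TV M N \<le> b"
proof -
  interpret M: prob_space M by fact
  interpret N: prob_space N by fact
  \<comment> \<open>The sign of \<open>b\<close> is needed when the approximating compact set is
    empty.\<close>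
  have "0 \<le> b" using le[of "\<lambda>_. 0"] by simp
  have one_sided: "measure M A - measure N A \<le> b" if A: "A \<in> sets borel" for A
  proof (rule field_le_epsilon)
    fix \<epsilon> :: real assume "0 < \<epsilon>"
    obtain K where K: "K \<subseteq> A" "compact K" "measure M A < measure M K + \<epsilon>"
    proof -
      have "\<exists>K. K \<subseteq> A \<and> compact K \<and> measure M A - \<epsilon> < measure M K"
      proof (rule ccontr)
        assume "\<not> ?thesis"
        then have *: "measure M K \<le> measure M A - \<epsilon>" if "K \<subseteq> A" "compact K" for K
          using that by (meson not_le)
        then have "0 \<le> measure M A - \<epsilon>"
          using *[of "{}"] by simp
        have "emeasure M A = (SUP K\<in>{K. K \<subseteq> A \<and> compact K}. emeasure M K)"
          by (rule inner_regular[OF M(2) _ A]) simp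
        also have "\<dots> \<le> ennreal (measure M A - \<epsilon>)"
          by (rule SUP_least) (auto simp: M.emeasure_eq_measure intro!: ennreal_leI *)
        finally have "measure M A \<le> measure M A - \<epsilon>"
          using \<open>0 \<le> measure M A - \<epsilon>\<close> by (simp add: M.emeasure_eq_measure)
        with \<open>0 < \<epsilon>\<close> show False by simp
      qed
      then show ?thesis using that by (auto simp: algebra_simps)
    qed
    have "measure M K - measure N K \<le> b"
    proof (cases "K = {}")
      case False
      then show ?thesis
        using measure_closed_diff_le[OF M N le] compact_imp_closed[OF K(2)] by blast
    qed (simp add: \<open>0 \<le> b\<close>)
    moreover have "measure N K \<le> measure N A"
      using K A by (intro N.finite_measure_mono) (auto simp: N(2))
    ultimately show "measure M A - measure N A \<le> b + \<epsilon>" using K(3) by simp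
  qed
  have "\<bar>measure M A - measure N A\<bar> \<le> b" if A: "A \<in> sets borel" for A
  proof -
    have "measure M (- A) = 1 - measure M A" "measure N (- A) = 1 - measure N A"
      using A M.prob_compl[of A] N.prob_compl[of A] M(2) N(2)
      by (simp_all add: sets_eq_imp_space_eq Compl_eq_Diff_UNIV)
    then show ?thesis using one_sided[OF A] one_sided[of "- A"] A by auto
  qed
  then show ?thesis
    unfolding d_TV_def by (intro cSUP_least) auto
qed

lemma d_TV_le_1:
  assumes "prob_space M" "sets M = sets borel" "prob_space N" "sets N = sets borel"
  shows "d_TV M N \<le> 1"
proof (rule d_TV_le_continuous_test_functions[OF assms])
  interpret M: prob_space M by fact
  fix u :: "real \<Rightarrow> real"
  assume u: "continuous_on UNIV u" "\<And>x. 0 \<le> u x" "\<And>x. u x \<le> 1"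
  have "u \<in> borel_measurable M"
    using assms(2) borel_measurable_continuous_onI[OF u(1)] measurable_cong_sets by blast
  then have "(\<integral>x. u x \<partial>M) \<le> 1"
    using u by (intro M.integral_le_const M.integrable_const_bound[where B=1]) auto
  moreover have "0 \<le> (\<integral>x. u x \<partial>N)" using u by simp
  ultimately show "(\<integral>x. u x \<partial>M) - (\<integral>x. u x \<partial>N) \<le> 1" by simp
qed

section \<open>Diagonalization of symmetric matrices\<close>

lemma inner_symmetric_matrix:
  fixes A :: "real ^ 'n ^ 'n"
  assumes "transpose A = A"
  shows "(A *v x) \<bullet> y = x \<bullet> (A *v y)"
  by (metis assms dot_lmul_matrix inner_commute transpose_matrix_vector)

text \<open>A maximiser \<open>v\<close> of the Rayleigh quotient on the unit sphere of \<open>S\<close>: for the residual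
  \<open>y = A v - \<mu> v\<close>, the quadratic inequality at \<open>v + t y\<close> would fail to first order in \<open>t\<close> unless \<open>y = 0\<close>.\<close>
lemma symmetric_matrix_eigenvector_in_subspace:
  fixes A :: "real ^ 'n ^ 'n"
  assumes sym: "transpose A = A" and S: "subspace S" "S \<noteq> {0}"
    and inv: "\<And>x. x \<in> S \<Longrightarrow> A *v x \<in> S"
  obtains v \<mu> where "v \<in> S" "norm v = 1" "A *v v = \<mu> *\<^sub>R v"
proof -
  let ?K = "S \<inter> sphere 0 1"
  obtain z where z: "z \<in> S" "z \<noteq> 0" using S subspace_0 by blast
  then have "z /\<^sub>R norm z \<in> ?K"
    using S(1) by (auto intro: subspace_scale)
  moreover have "compact ?K"
    using S(1) by (intro closed_Int_compact closed_subspace) auto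
  moreover have "continuous_on ?K (\<lambda>x. x \<bullet> (A *v x))"
    by (intro continuous_intros linear_continuous_on) (simp add: linear_conv_bounded_linear[symmetric])
  ultimately obtain v where v: "v \<in> ?K" and max: "\<And>x. x \<in> ?K \<Longrightarrow> x \<bullet> (A *v x) \<le> v \<bullet> (A *v v)"
    using continuous_attains_sup[of ?K "\<lambda>x. x \<bullet> (A *v x)"] by blast
  define \<mu> where "\<mu> = v \<bullet> (A *v v)"
  have vS: "v \<in> S" "norm v = 1" using v by auto
  have quad: "x \<bullet> (A *v x) \<le> \<mu> * (x \<bullet> x)" if "x \<in> S" for x
  proof (cases "x = 0")
    case False
    have "(x /\<^sub>R norm x) \<bullet> (A *v (x /\<^sub>R norm x)) \<le> \<mu>"
      unfolding \<mu>_def using that False S(1) by (intro max) (auto intro: subspace_scale)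
    then have "(x \<bullet> (A *v x)) / (norm x * norm x) \<le> \<mu>"
      by (simp add: matrix_vector_mult_scaleR divide_inverse mult_ac)
    then have "x \<bullet> (A *v x) \<le> \<mu> * (norm x * norm x)"
      using False by (simp add: divide_le_eq)
    then show ?thesis by (simp add: dot_square_norm power2_eq_square)
  qed simp
  define y where "y = A *v v - \<mu> *\<^sub>R v"
  have yS: "y \<in> S"
    unfolding y_def using vS inv S(1) by (auto intro: subspace_diff subspace_scale)
  define c where "c = \<mu> * (y \<bullet> y) - y \<bullet> (A *v y)"
  \<comment> \<open>Since \<open>A *v v\<close> is \<open>y\<close> plus \<open>\<mu>\<close> times
    \<open>v\<close>, the terms with \<open>y \<bullet> v\<close> cancel and the first order part is
    \<open>2 * t * (y \<bullet> y)\<close>.\<close>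
  have first_order: "2 * t * (y \<bullet> y) \<le> t\<^sup>2 * c" for t :: real
  proof -
    have "v + t *\<^sub>R y \<in> S" using vS yS S(1) by (auto intro: subspace_add subspace_scale)
    from quad[OF this] have "\<mu> + 2 * t * (y \<bullet> (A *v v)) + t\<^sup>2 * (y \<bullet> (A *v y))
        \<le> \<mu> * (1 + 2 * t * (y \<bullet> v) + t\<^sup>2 * (y \<bullet> y))"
      using vS(2) inner_symmetric_matrix[OF sym, of v y]
      by (simp add: matrix_vector_right_distrib matrix_vector_mult_scaleR inner_add_left inner_add_right
          \<mu>_def[symmetric] dot_square_norm[of v] inner_commute power2_eq_square algebra_simps)
    moreover have Av: "y \<bullet> (A *v v) = y \<bullet> y + \<mu> * (y \<bullet> v)"
      by (subst (3) y_def) (simp add: inner_diff_right)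
    ultimately show ?thesis
      unfolding Av by (simp add: c_def algebra_simps)
  qed
  have "y \<bullet> y = 0"
  proof (rule ccontr)
    assume "y \<bullet> y \<noteq> 0"
    then have pos: "y \<bullet> y > 0" by (simp add: inner_gt_zero_iff)
    \<comment> \<open>With this \<open>t\<close>, \<open>t * c\<close> is at most
      \<open>y \<bullet> y\<close>, against the lower bound \<open>2 * (y \<bullet> y)\<close> from
      \<open>first_order\<close>.\<close>
    define t where "t = (y \<bullet> y) / (\<bar>c\<bar> + 1)"
    have t: "t > 0" using pos by (simp add: t_def)
    have "t * (2 * (y \<bullet> y)) \<le> t * (t * c)"
      using first_order[of t] by (simp add: power2_eq_square mult_ac)
    then have "2 * (y \<bullet> y) \<le> t * c" using t by simp
    also have "\<dots> \<le> t * (\<bar>c\<bar> + 1)" using t by (intro mult_left_mono) auto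
    also have "\<dots> = y \<bullet> y" by (simp add: t_def)
    finally show False using pos by simp
  qed
  then have "A *v v = \<mu> *\<^sub>R v" by (simp add: y_def)
  with vS show thesis using that by blast
qed

text \<open>Induction over invariant subspaces: symmetry makes the complement of an eigenvector
  inside \<open>S\<close> invariant again, with dimension one less.\<close>

lemma symmetric_matrix_orthonormal_eigenvectors:
  fixes A :: "real ^ 'n ^ 'n"
  assumes sym: "transpose A = A" and "subspace S" and inv: "\<And>x. x \<in> S \<Longrightarrow> A *v x \<in> S"
  shows "\<exists>B. B \<subseteq> S \<and> finite B \<and> card B = dim S \<and> pairwise orthogonal B \<and>
      (\<forall>b\<in>B. norm b = 1 \<and> (\<exists>\<mu>. A *v b = \<mu> *\<^sub>R b))"
  using assms(2,3)
proof (induction "dim S" arbitrary: S)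
  case 0
  then show ?case by (intro exI[of _ "{}"]) auto
next
  case (Suc k)
  have "S \<noteq> {0}" using Suc.hyps(2) by auto
  then obtain v \<mu> where v: "v \<in> S" "norm v = 1" "A *v v = \<mu> *\<^sub>R v"
    using symmetric_matrix_eigenvector_in_subspace[OF sym Suc.prems(1) _ Suc.prems(2)] by blast
  let ?T = "{y \<in> S. orthogonal v y}"
  have T: "subspace ?T"
    using Suc.prems(1) by (auto simp: subspace_def orthogonal_def inner_add_right)
  have "span {v} \<subseteq> S" using v(1) Suc.prems(1) by (simp add: span_minimal)
  moreover have "?T = {y \<in> S. \<forall>x \<in> span {v}. orthogonal x y}"
    by (auto simp: span_singleton orthogonal_def intro: exI[of _ 1])
  ultimately have "dim ?T + dim (span {v}) = dim S"
    using dim_subspace_orthogonal_to_vectors[of "span {v}" S] Suc.prems(1) by simp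
  moreover have "dim (span {v}) = 1"
    using v(2) by (subst dim_span, subst dim_singleton) auto
  ultimately have dimT: "dim ?T = k" using Suc.hyps(2) by simp
  have "A *v x \<in> ?T" if "x \<in> ?T" for x
    using that Suc.prems(2) inner_symmetric_matrix[OF sym, of v x] v(3)
    by (auto simp: orthogonal_def)
  with Suc.hyps(1)[of ?T] dimT T obtain B where B: "B \<subseteq> ?T" "finite B" "card B = dim ?T"
    "pairwise orthogonal B" "\<forall>b\<in>B. norm b = 1 \<and> (\<exists>\<mu>. A *v b = \<mu> *\<^sub>R b)" by blast
  have "v \<notin> B" using B(1) v(2) by (auto simp: orthogonal_def)
  show ?case
  proof (intro exI[of _ "insert v B"] conjI)
    show "card (insert v B) = dim S"
      using B \<open>v \<notin> B\<close> dimT Suc.hyps(2) by simp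
    show "pairwise orthogonal (insert v B)"
      using B by (auto simp: pairwise_insert orthogonal_commute)
  qed (use B v in auto)
qed

lemma symmetric_matrix_diagonalization:
  fixes A :: "real ^ 'n ^ 'n"
  assumes "transpose A = A"
  obtains P :: "real ^ 'n ^ 'n" and e :: "real ^ 'n" where "orthogonal_matrix P"
    "A = P ** (\<chi> i j. if i = j then e $ i else 0) ** transpose P"
proof -
  obtain B where B: "finite B" "card B = CARD('n)" "pairwise orthogonal B"
      "\<forall>b\<in>B. norm b = 1 \<and> (\<exists>\<mu>. A *v b = \<mu> *\<^sub>R b)"
    using symmetric_matrix_orthonormal_eigenvectors[OF assms, of UNIV] by auto
  then obtain f where f: "bij_betw f (UNIV::'n set) B"
    using finite_same_card_bij[of "UNIV :: 'n set" B] by auto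
  then have fB: "f i \<in> B" for i by (auto simp: bij_betw_def)
  then have "\<forall>i. \<exists>\<mu>. A *v f i = \<mu> *\<^sub>R f i" using B(4) by blast
  from choice[OF this] obtain \<mu> where \<mu>: "\<And>i. A *v f i = \<mu> i *\<^sub>R f i" by blast
  define P :: "real ^ 'n ^ 'n" where "P = (\<chi> i j. f j $ i)"
  define e :: "real ^ 'n" where "e = (\<chi> i. \<mu> i)"
  let ?D = "(\<chi> i j. if i = j then e $ i else 0) :: real ^ 'n ^ 'n"
  have col: "column j P = f j" for j
    by (simp add: column_def P_def vec_eq_iff)
  have "orthogonal (f i) (f j)" if "i \<noteq> j" for i j
    using that B(3) fB f by (intro pairwiseD[of orthogonal B]) (auto simp: bij_betw_def inj_on_def)
  then have P: "orthogonal_matrix P"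
    using B(4) fB by (simp add: orthogonal_matrix_orthonormal_columns col)
  have "(A ** P) $ i $ j = (P ** ?D) $ i $ j" for i j
  proof -
    have "(A ** P) $ i $ j = (A *v f j) $ i"
      by (simp add: matrix_matrix_mult_def matrix_vector_mult_def P_def)
    also have "\<dots> = (P ** ?D) $ i $ j"
      by (simp add: \<mu> matrix_matrix_mult_def P_def e_def if_distrib[of "\<lambda>x. _ * x"] cong: if_cong)
    finally show ?thesis .
  qed
  then have "A ** P = P ** ?D" by (simp add: vec_eq_iff)
  then have "A ** (P ** transpose P) = P ** ?D ** transpose P"
    by (simp add: matrix_mul_assoc)
  then have "A = P ** ?D ** transpose P"
    using P by (simp add: orthogonal_matrix_def)
  with P show thesis by (rule that)
qed

section \<open>Diagonalised forms and the multiset of eigenvalues\<close>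

lemma quad_form_eq_inner: "quad_form A x = x \<bullet> (A *v x)"
  by (simp add: quad_form_def inner_vec_def matrix_vector_mult_def sum_distrib_left mult_ac)

lemma quad_form_diagonalization:
  fixes P :: "real ^ 'n ^ 'n" and e :: "real ^ 'n"
  assumes P: "orthogonal_matrix P"
    and A: "A = P ** (\<chi> i j. if i = j then e $ i else 0) ** transpose P"
  shows "quad_form A (P *v y) = (\<Sum>k\<in>UNIV. e $ k * (y $ k)\<^sup>2)"
proof -
  let ?D = "(\<chi> i j. if i = j then e $ i else 0) :: real ^ 'n ^ 'n"
  have "A *v (P *v y) = P *v (?D *v ((transpose P ** P) *v y))"
    by (simp add: A matrix_vector_mul_assoc matrix_mul_assoc)
  also have "\<dots> = P *v (?D *v y)"
    using P by (simp add: orthogonal_matrix_def)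
  finally have "quad_form A (P *v y) = (P *v y) \<bullet> (P *v (?D *v y))"
    by (simp add: quad_form_eq_inner)
  also have "\<dots> = y \<bullet> (?D *v y)"
    using P orthogonal_transformation_matrix[of "(*v) P"]
    by (simp add: orthogonal_transformation_def matrix_of_matrix_vector_mul)
  also have "\<dots> = (\<Sum>k\<in>UNIV. e $ k * (y $ k)\<^sup>2)"
    by (simp add: inner_vec_def matrix_vector_mult_def if_distrib[of "\<lambda>x. x * _"] power2_eq_square
        mult.left_commute cong: if_cong)
  finally show ?thesis .
qed

lemma matrix_diff_ldistrib: "A ** (B - C) = A ** B - A ** (C :: 'a::ring_1 ^ 'n ^ 'm)"
  by (simp add: vec_eq_iff matrix_matrix_mult_def sum_subtractf algebra_simps)

lemma matrix_diff_rdistrib: "(B - C) ** A = B ** A - (C :: 'a::ring_1 ^ 'n ^ 'm) ** A"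
  by (simp add: vec_eq_iff matrix_matrix_mult_def sum_subtractf algebra_simps)

text \<open>\<open>mat t\<close> commutes with \<open>P\<close>, so \<open>mat t - A\<close> is
  conjugate to a diagonal matrix. This links the diagonal entries \<open>e\<close> to the given
  vector \<open>d\<close>, which is known only through the characteristic polynomial.\<close>

lemma charpoly_diagonalization:
  fixes P :: "real ^ 'n ^ 'n" and e :: "real ^ 'n"
  assumes P: "orthogonal_matrix P"
    and A: "A = P ** (\<chi> i j. if i = j then e $ i else 0) ** transpose P"
  shows "det (mat t - A) = (\<Prod>i\<in>UNIV. t - e $ i)"
proof -
  let ?D = "(\<chi> i j. if i = j then e $ i else 0) :: real ^ 'n ^ 'n"
  have "A ** P = P ** ?D ** (transpose P ** P)"
    by (simp add: A matrix_mul_assoc)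
  then have "A ** P = P ** ?D"
    using P by (simp add: orthogonal_matrix_def)
  moreover have "mat t ** P = P ** mat t"
    by (simp add: vec_eq_iff matrix_matrix_mult_def mat_def if_distrib[of "\<lambda>x. x * _"]
        if_distrib[of "\<lambda>x. _ * x"] mult.commute cong: if_cong)
  ultimately have "(mat t - A) ** P = P ** (mat t - ?D)"
    by (simp add: matrix_diff_ldistrib matrix_diff_rdistrib)
  from arg_cong[OF this, of det] have "det (mat t - A) * det P = det P * det (mat t - ?D)"
    by (simp only: det_mul)
  moreover have "det P \<noteq> 0"
    using det_orthogonal_matrix[OF P] by auto
  moreover have "det (mat t - ?D) = (\<Prod>i\<in>UNIV. t - e $ i)"
    by (subst det_diagonal) (auto simp: mat_def)
  ultimately show ?thesis by simp
qed

text \<open>Equal polynomials have the same multiset of roots, so the two families agree up to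
  order; comparing sums avoids choosing a permutation.\<close>

lemma sum_roots_eq:
  fixes d e :: "'i \<Rightarrow> real"
  assumes "finite I" and eq: "\<And>t. (\<Prod>i\<in>I. t - d i) = (\<Prod>i\<in>I. t - e i)"
  shows "(\<Sum>i\<in>I. f (d i)) = (\<Sum>i\<in>I. f (e i) :: real)"
proof -
  have roots: "proots (\<Prod>i\<in>I. [:- g i, 1:]) = image_mset g (mset_set I)" for g :: "'i \<Rightarrow> real"
    using \<open>finite I\<close> by (subst proots_prod) (simp, induction I rule: finite_induct, simp_all)
  have "(\<Prod>i\<in>I. [:- d i, 1:]) = (\<Prod>i\<in>I. [:- e i, 1:])"
    using eq by (simp add: poly_eq_poly_eq_iff[symmetric] fun_eq_iff poly_prod)
  then have "image_mset d (mset_set I) = image_mset e (mset_set I)"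
    using roots by metis
  then have "sum_mset (image_mset f (image_mset d (mset_set I))) = sum_mset (image_mset f (image_mset e (mset_set I)))"
    by simp
  then show ?thesis by (simp add: sum_unfold_sum_mset image_mset.compositionality comp_def)
qed

section \<open>The bound for quadratic forms\<close>

lemma integral_diag_form:
  fixes a :: "real ^ 'n"
  shows "(\<integral>x. (\<Sum>k\<in>UNIV. a $ k * (x $ k)\<^sup>2) \<partial>sphere_measure) = (\<Sum>k\<in>UNIV. a $ k) / real CARD('n)"
proof -
  have "integrable sphere_measure (\<lambda>x::real^'n. a $ k * (x $ k)\<^sup>2)" for k
    by (intro integrable_sphere_measure_continuous continuous_intros)
  then show ?thesis
    by (simp add: sphere_second_moment sum_divide_distrib)
qed

text \<open>Up to normalisation the fourth moments are 1 plus an extra 2 on the diagonal: the first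
  part yields the squared sum, the second the sum of squares. Applied to \<open>e\<close>, whose sum
  is 0, and to the vector of its squared entries.\<close>

lemma integral_diag_form_square:
  fixes a :: "real ^ 'n"
  shows "(\<integral>x. (\<Sum>k\<in>UNIV. a $ k * (x $ k)\<^sup>2)\<^sup>2 \<partial>sphere_measure)
    = (2 * (\<Sum>k\<in>UNIV. (a $ k)\<^sup>2) + (\<Sum>k\<in>UNIV. a $ k)\<^sup>2) / (real CARD('n) * (real CARD('n) + 2))"
proof -
  let ?N = "real CARD('n) * (real CARD('n) + 2)"
  have "integrable sphere_measure (\<lambda>x::real^'n. (a $ i * a $ j) * ((x $ i)\<^sup>2 * (x $ j)\<^sup>2))" for i j
    by (intro integrable_sphere_measure_continuous continuous_intros)
  then have "(\<integral>x. (\<Sum>k\<in>UNIV. a $ k * (x $ k)\<^sup>2)\<^sup>2 \<partial>sphere_measure)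
      = (\<Sum>i\<in>UNIV. \<Sum>j\<in>UNIV. (a $ i * a $ j) * ((if i = j then 3 else 1) / ?N))"
    by (simp add: power2_eq_square[of "sum _ _"] sum_product mult_ac flip: sphere_fourth_moment)
  also have "\<dots> = (\<Sum>i\<in>UNIV. \<Sum>j\<in>UNIV. (a $ i * a $ j + (if i = j then 2 * (a $ i)\<^sup>2 else 0)) / ?N)"
    by (intro sum.cong) (auto simp: power2_eq_square)
  also have "\<dots> = (2 * (\<Sum>k\<in>UNIV. (a $ k)\<^sup>2) + (\<Sum>k\<in>UNIV. a $ k)\<^sup>2) / ?N"
  proof -
    have "(\<Sum>k\<in>UNIV. a $ k)\<^sup>2 = (\<Sum>i\<in>UNIV. \<Sum>j\<in>UNIV. a $ i * a $ j)"
      by (simp add: power2_eq_square sum_product)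
    then show ?thesis
      by (simp add: sum.distrib sum_distrib_left flip: sum_divide_distrib)
  qed
  finally show ?thesis .
qed

lemma (in prob_space) expectation_abs_square_le:
  fixes X :: "'a \<Rightarrow> real"
  assumes [measurable]: "X \<in> borel_measurable M" and "integrable M (\<lambda>x. (X x)\<^sup>2)"
  shows "(expectation (\<lambda>x. \<bar>X x\<bar>))\<^sup>2 \<le> expectation (\<lambda>x. (X x)\<^sup>2)"
proof -
  have "integrable M X" using assms by (rule square_integrable_imp_integrable)
  then have "variance (\<lambda>x. \<bar>X x\<bar>) = expectation (\<lambda>x. (X x)\<^sup>2) - (expectation (\<lambda>x. \<bar>X x\<bar>))\<^sup>2"
    using variance_eq[of "\<lambda>x. \<bar>X x\<bar>"] assms by simp
  then show ?thesis using variance_positive[of "\<lambda>x. \<bar>X x\<bar>"] by simp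
qed

lemma prob_space_std_gaussian: "prob_space std_gaussian"
  by (simp add: std_gaussian_def prob_space_normal_density)

lemma sets_std_gaussian [simp]: "sets std_gaussian = sets borel"
  by (simp add: std_gaussian_def)

lemma d_TV_diag_form_le:
  fixes e :: "real ^ 'n" and C :: real
  assumes tr: "(\<Sum>k\<in>UNIV. e $ k) = 0"
  defines "W \<equiv> \<lambda>x::real^'n. C * (\<Sum>k\<in>UNIV. e $ k * (x $ k)\<^sup>2)"
    and "T \<equiv> \<lambda>x::real^'n. 2 * C\<^sup>2 / real CARD('n) *
      ((\<Sum>k\<in>UNIV. (e $ k)\<^sup>2 * (x $ k)\<^sup>2) - (\<Sum>k\<in>UNIV. e $ k * (x $ k)\<^sup>2)\<^sup>2)"
  shows "d_TV (distr sphere_measure borel W) std_gaussian \<le> (\<integral>x. \<bar>1 - T x\<bar> \<partial>sphere_measure)"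
proof -
  interpret prob_space "sphere_measure :: (real^'n) measure" by (rule prob_space_sphere_measure)
  have cont: "continuous_on UNIV W" "continuous_on UNIV T"
    unfolding W_def T_def by (intro continuous_intros)+
  note [measurable] = borel_measurable_continuous_onI[OF cont(1)]
  show ?thesis
  proof (rule d_TV_le_continuous_test_functions)
    show "prob_space (distr sphere_measure borel W)"
      by (rule prob_space_distr) simp
    fix u :: "real \<Rightarrow> real"
    assume u: "continuous_on UNIV u" "\<And>x. 0 \<le> u x" "\<And>x. u x \<le> 1"
    note [measurable] = borel_measurable_continuous_onI[OF u(1)]
    obtain h h' where h: "\<And>w. (h has_real_derivative h' w) (at w)" "continuous_on UNIV h'"
        "\<And>w. \<bar>h' w\<bar> \<le> 1" "\<And>w. h' w - w * h w = u w - (\<integral>x. u x \<partial>std_gaussian)"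
      using gaussian_stein_solution[OF u] by blast
    have cont_h: "continuous_on UNIV h"
      using h(1) by (intro DERIV_continuous_on) auto
    note cont_W = continuous_on_compose2[OF h(2) cont(1) subset_UNIV] continuous_on_compose2[OF cont_h cont(1) subset_UNIV]
      continuous_on_compose2[OF u(1) cont(1) subset_UNIV] cont
    note int = integrable_sphere_measure_continuous
    have stein: "(\<integral>x. W x * h (W x) \<partial>sphere_measure) = (\<integral>x. h' (W x) * T x \<partial>sphere_measure)"
      unfolding W_def sphere_quadratic_stein_identity[OF tr h(1,2)] by (simp add: T_def mult_ac)
    have "(\<integral>x. u x \<partial>distr sphere_measure borel W) - (\<integral>x. u x \<partial>std_gaussian)
        = (\<integral>x. u (W x) - (\<integral>x. u x \<partial>std_gaussian) \<partial>sphere_measure)"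
      using int[OF cont_W(3)] prob_space by (simp add: integral_distr)
    also have "\<dots> = (\<integral>x. h' (W x) - W x * h (W x) \<partial>sphere_measure)"
      by (simp add: h(4))
    \<comment> \<open>Under the integral \<open>W x * h (W x)\<close> is traded for
      \<open>h' (W x) * T x\<close>, which leaves the bounded factor \<open>h' (W x)\<close> in
      front of \<open>1 - T x\<close>.\<close>
    also have "\<dots> = (\<integral>x. h' (W x) - h' (W x) * T x \<partial>sphere_measure)"
      by (simp add: stein int continuous_intros cont_W)
    also have "\<dots> \<le> (\<integral>x. \<bar>1 - T x\<bar> \<partial>sphere_measure)"
    proof (rule integral_mono)
      show "h' (W x) - h' (W x) * T x \<le> \<bar>1 - T x\<bar>" for x
      proof -
        have "h' (W x) - h' (W x) * T x = h' (W x) * (1 - T x)" by (simp add: algebra_simps)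
        also have "\<dots> \<le> \<bar>h' (W x)\<bar> * \<bar>1 - T x\<bar>" by (metis abs_ge_self abs_mult)
        also have "\<dots> \<le> \<bar>1 - T x\<bar>" using h(3) by (intro mult_left_le_one_le) auto
        finally show ?thesis .
      qed
    qed (intro int continuous_intros cont_W)+
    finally show "(\<integral>x. u x \<partial>distr sphere_measure borel W) - (\<integral>x. u x \<partial>std_gaussian)
        \<le> (\<integral>x. \<bar>1 - T x\<bar> \<partial>sphere_measure)" .
  qed (auto simp: prob_space_std_gaussian)
qed

text \<open>The factor \<open>6\<close> leaves enough room to estimate the fluctuation of \<open>g\<^sup>2\<close> by twice its mean, so
  that moments of order four suffice.\<close>
lemma d_TV_diag_form:
  fixes e :: "real ^ 'n" and C :: real
  assumes tr: "(\<Sum>k\<in>UNIV. e $ k) = 0"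
    and norm: "(\<integral>x. (C * (\<Sum>k\<in>UNIV. e $ k * (x $ k)\<^sup>2))\<^sup>2 \<partial>sphere_measure) = 1"
  shows "d_TV (distr sphere_measure borel (\<lambda>x. C * (\<Sum>k\<in>UNIV. e $ k * (x $ k)\<^sup>2))) std_gaussian
    \<le> sqrt 6 * (sqrt (\<Sum>k\<in>UNIV. (e $ k) ^ 4) / (\<Sum>k\<in>UNIV. (e $ k)\<^sup>2))"
    (is "?d \<le> _")
proof -
  interpret prob_space "sphere_measure :: (real^'n) measure" by (rule prob_space_sphere_measure)
  define n where "n = real CARD('n)"
  define s2 where "s2 = (\<Sum>k\<in>UNIV. (e $ k)\<^sup>2)"
  define s4 where "s4 = (\<Sum>k\<in>UNIV. (e $ k) ^ 4)"
  define g where "g x = (\<Sum>k\<in>UNIV. e $ k * (x $ k)\<^sup>2)" for x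
  define Q where "Q x = (\<Sum>k\<in>UNIV. (e $ k)\<^sup>2 * (x $ k)\<^sup>2)" for x
  have n: "n > 0" "n + 2 \<noteq> 0" by (simp_all add: n_def add_nonneg_eq_0_iff)
  have cont: "continuous_on UNIV g" "continuous_on UNIV Q"
    unfolding g_def Q_def by (intro continuous_intros)+
  note int = integrable_sphere_measure_continuous
  have Eg2: "expectation (\<lambda>x. (g x)\<^sup>2) = 2 * s2 / (n * (n + 2))"
    using integral_diag_form_square[of e] by (simp add: g_def tr s2_def n_def)
  have EQ: "expectation Q = s2 / n"
    using integral_diag_form[of "\<chi> k. (e $ k)\<^sup>2"] by (simp add: Q_def[abs_def] s2_def n_def)
  have EQ2: "expectation (\<lambda>x. (Q x)\<^sup>2) = (2 * s4 + s2\<^sup>2) / (n * (n + 2))"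
    using integral_diag_form_square[of "\<chi> k. (e $ k)\<^sup>2"]
    by (simp add: Q_def s2_def s4_def n_def)
  \<comment> \<open>The normalisation determines \<open>C\<^sup>2\<close> and excludes
    \<open>e = 0\<close>.\<close>
  have C: "C\<^sup>2 * (2 * s2) = n * (n + 2)"
    using norm Eg2 n unfolding g_def[symmetric] by (simp add: power_mult_distrib field_simps)
  have "s2 \<noteq> 0" using C n by auto
  moreover have "s2 \<ge> 0" by (simp add: s2_def sum_nonneg)
  ultimately have s2: "s2 > 0" by simp
  define a where "a = 2 * C\<^sup>2 / n"
  have a: "a = (n + 2) / s2" using C n s2 by (simp add: a_def field_simps)
  have "a > 0" using n s2 by (simp add: a)
  define p where "p = a * expectation (\<lambda>x. \<bar>Q x - s2 / n\<bar>)"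
  \<comment> \<open>\<open>r\<close> is the fourth power of the ratio of the 4-norm to the 2-norm of
    \<open>e\<close>, so the goal becomes \<open>?d \<le> sqrt (6 * r)\<close>.\<close>
  define r where "r = s4 / s2\<^sup>2"
  define x where "x = 1 / n"
  have x: "x > 0" using n by (simp add: x_def)
  have "?d \<le> expectation (\<lambda>x. \<bar>1 - a * (Q x - (g x)\<^sup>2)\<bar>)"
    using d_TV_diag_form_le[OF tr, of C] by (simp add: a_def Q_def g_def n_def)
  also have "\<dots> \<le> expectation (\<lambda>x. a * \<bar>Q x - s2 / n\<bar> + a * ((g x)\<^sup>2 + 2 * s2 / (n * (n + 2))))"
  proof (rule integral_mono)
    fix x
    \<comment> \<open>This is E T = 1, split into the means of \<open>Q\<close> and
      \<open>g\<^sup>2\<close> so that both can be centred.\<close>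
    have "1 = a * (s2 / n - 2 * s2 / (n * (n + 2)))"
      using n s2 by (simp add: a divide_simps) (simp add: algebra_simps)
    then have "1 - a * (Q x - (g x)\<^sup>2) = a * (((g x)\<^sup>2 - 2 * s2 / (n * (n + 2))) - (Q x - s2 / n))"
      by (simp add: algebra_simps)
    then have "\<bar>1 - a * (Q x - (g x)\<^sup>2)\<bar> = a * \<bar>((g x)\<^sup>2 - 2 * s2 / (n * (n + 2))) - (Q x - s2 / n)\<bar>"
      using \<open>a > 0\<close> by (simp add: abs_mult)
    also have "\<dots> \<le> a * (\<bar>Q x - s2 / n\<bar> + ((g x)\<^sup>2 + 2 * s2 / (n * (n + 2))))"
    proof (rule mult_left_mono)
      have "0 \<le> 2 * s2 / (n * (n + 2))" "0 \<le> (g x)\<^sup>2" using n s2 by auto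
      then show "\<bar>((g x)\<^sup>2 - 2 * s2 / (n * (n + 2))) - (Q x - s2 / n)\<bar>
          \<le> \<bar>Q x - s2 / n\<bar> + ((g x)\<^sup>2 + 2 * s2 / (n * (n + 2)))" by arith
    qed (use \<open>a > 0\<close> in simp)
    finally show "\<bar>1 - a * (Q x - (g x)\<^sup>2)\<bar> \<le> a * \<bar>Q x - s2 / n\<bar> + a * ((g x)\<^sup>2 + 2 * s2 / (n * (n + 2)))"
      by (simp add: algebra_simps)
  qed (intro int continuous_intros cont)+
  also have "\<dots> = p + a * (2 * (2 * s2 / (n * (n + 2))))"
    using prob_space by (simp add: p_def int continuous_intros cont Eg2)
  also have "\<dots> = p + 4 * x"
    using n s2 by (simp add: a x_def divide_simps) (simp add: algebra_simps)
  finally have d: "?d \<le> p + 4 * x" .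
  have "p\<^sup>2 \<le> a\<^sup>2 * expectation (\<lambda>x. (Q x - s2 / n)\<^sup>2)"
    unfolding p_def power_mult_distrib
    by (intro mult_left_mono expectation_abs_square_le borel_measurable_integrable int continuous_intros cont) auto
  also have "expectation (\<lambda>x. (Q x - s2 / n)\<^sup>2) = (2 * s4 + s2\<^sup>2) / (n * (n + 2)) - (s2 / n)\<^sup>2"
    using variance_eq[of Q] by (simp add: EQ EQ2 int continuous_intros cont)
  also have "a\<^sup>2 * \<dots> = 2 * (1 + 2 * x) * (r - x)"
    using n s2 by (simp add: a x_def r_def divide_simps power2_eq_square) (simp add: algebra_simps)
  finally have p: "p\<^sup>2 \<le> 2 * (1 + 2 * x) * (r - x)" .
  \<comment> \<open>A bound on a square is nonnegative, so the variance computation already contains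
    the Cauchy-Schwarz inequality \<open>1 / n \<le> r\<close>.\<close>
  have "0 \<le> (1 + 2 * x) * (r - x)" using p zero_le_power2[of p] by linarith
  then have xr: "x \<le> r" using x by (simp add: zero_le_mult_iff)
  have "?d \<le> sqrt (6 * r)"
  proof (cases "6 * r \<ge> 1")
    case True
    have "?d \<le> 1"
      by (intro d_TV_le_1 prob_space_distr prob_space_std_gaussian)
         (auto intro!: borel_measurable_continuous_onI continuous_intros)
    also have "1 \<le> sqrt (6 * r)" using True by simp
    finally show ?thesis .
  next
    case False
    have "(p + 4 * x)\<^sup>2 \<le> 2 * p\<^sup>2 + 2 * (4 * x)\<^sup>2"
      using sum_squares_bound[of p "4 * x"] by (simp add: power2_sum)
    also have "\<dots> \<le> 4 * (1 + 2 * x) * (r - x) + 32 * x\<^sup>2"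
      using p by (simp add: power_mult_distrib algebra_simps)
    also have "\<dots> = 4 * r - 4 * x + 8 * (x * r) + 24 * (x * x)"
      by (simp add: power2_eq_square algebra_simps)
    \<comment> \<open>Here \<open>r < 1 / 6\<close>, hence also \<open>x < 1 / 6\<close>. Bounding
      one factor of each product leaves \<open>4 * r + 4 / 3 * x\<close>, which
      \<open>x \<le> r\<close> keeps below \<open>6 * r\<close>.\<close>
    also have "\<dots> \<le> 4 * r - 4 * x + 8 * (x * (1 / 6)) + 24 * (x * (1 / 6))"
      using x xr False by (intro add_mono mult_left_mono) auto
    also have "\<dots> \<le> 6 * r" using x xr by simp
    finally have "p + 4 * x \<le> sqrt (6 * r)"
      by (rule real_le_rsqrt)
    with d show ?thesis by simp
  qed
  also have "sqrt (6 * r) = sqrt 6 * (sqrt s4 / s2)"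
    using s2 by (simp add: r_def real_sqrt_mult real_sqrt_divide)
  finally show ?thesis by (simp add: s2_def s4_def)
qed

lemma lp_norm_ratio_square:
  fixes d :: "real ^ 'n"
  shows "(lp_norm 4 d / lp_norm 2 d)\<^sup>2 = sqrt (\<Sum>i\<in>UNIV. (d $ i) ^ 4) / (\<Sum>i\<in>UNIV. (d $ i)\<^sup>2)"
proof -
  have p4: "\<bar>t\<bar> powr 4 = t ^ 4" and p2: "\<bar>t\<bar> powr 2 = t\<^sup>2" for t :: real
    by (simp_all add: powr_numeral power_even_abs)
  have sq: "(s powr (1 / 4))\<^sup>2 = sqrt s" "(s powr (1 / 2))\<^sup>2 = s" if "s \<ge> 0" for s :: real
    using that by (simp_all add: power2_eq_square powr_half_sqrt flip: powr_add)
  show ?thesis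
    by (simp add: lp_norm_def p4 p2 power_divide sq sum_nonneg)
qed

theorem theorem3p3:
  fixes A :: "real ^ 'n ^ 'n" and C :: real and d :: "real ^ 'n"
  assumes "CARD('n) \<ge> 2"
    and "transpose A = A"
    and "trace A = 0"
    and "(\<integral>x. (C * quad_form A x)\<^sup>2 \<partial>sphere_measure) = 1"
    and "\<And>t::real. det (mat t - A) = (\<Prod>i\<in>UNIV. t - d $ i)"
  shows "d_TV (distr sphere_measure borel (\<lambda>x. C * quad_form A x)) std_gaussian
           \<le> sqrt 6 * (lp_norm 4 d / lp_norm 2 d)\<^sup>2"
proof -
  obtain P :: "real ^ 'n ^ 'n" and e :: "real ^ 'n" where P: "orthogonal_matrix P"
      and A: "A = P ** (\<chi> i j. if i = j then e $ i else 0) ** transpose P"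
    using symmetric_matrix_diagonalization[OF assms(2)] .
  let ?D = "(\<chi> i j. if i = j then e $ i else 0) :: real ^ 'n ^ 'n"
  have tr: "(\<Sum>k\<in>UNIV. e $ k) = 0"
  proof -
    have "trace A = trace (transpose P ** (P ** ?D))"
      unfolding A by (rule trace_mul_sym)
    also have "\<dots> = trace ?D"
      using P by (simp add: matrix_mul_assoc orthogonal_matrix_def)
    finally show ?thesis using assms(3) by (simp add: trace_def)
  qed
  \<comment> \<open>\<open>d\<close> may list the eigenvalues in another order than
    \<open>e\<close>; the bound involves only their power sums of order 2 and 4.\<close>
  have sums: "(\<Sum>i\<in>UNIV. f (d $ i)) = (\<Sum>i\<in>UNIV. f (e $ i))" for f :: "real \<Rightarrow> real"
    using charpoly_diagonalization[OF P A] assms(5) by (intro sum_roots_eq) auto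
  have U: "orthogonal_transformation ((*v) P)"
    using P by (simp add: orthogonal_transformation_matrix matrix_of_matrix_vector_mul)
  note [measurable] = borel_measurable_orthogonal_transformation[OF U]
  have "continuous_on UNIV (\<lambda>x. C * quad_form A x)"
    unfolding quad_form_def by (intro continuous_intros)
  note [measurable] = borel_measurable_continuous_onI[OF this]
  \<comment> \<open>Replacing the random point by its image under \<open>P\<close>, which has the
    same law, diagonalises the form.\<close>
  have "distr sphere_measure borel (\<lambda>x. C * quad_form A x)
      = distr (distr sphere_measure borel ((*v) P)) borel (\<lambda>x. C * quad_form A x)"
    by (simp add: distr_sphere_measure_orthogonal_transformation[OF U])
  also have "\<dots> = distr sphere_measure borel (\<lambda>x. C * (\<Sum>k\<in>UNIV. e $ k * (x $ k)\<^sup>2))"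
    by (simp add: distr_distr comp_def quad_form_diagonalization[OF P A])
  finally have distr: "distr sphere_measure borel (\<lambda>x. C * quad_form A x)
      = distr sphere_measure borel (\<lambda>x. C * (\<Sum>k\<in>UNIV. e $ k * (x $ k)\<^sup>2))" .
  have "(\<integral>x. (C * (\<Sum>k\<in>UNIV. e $ k * (x $ k)\<^sup>2))\<^sup>2 \<partial>sphere_measure) = 1"
    using integral_sphere_measure_orthogonal_transformation[OF U, of "\<lambda>x. (C * quad_form A x)\<^sup>2"] assms(4)
    by (simp add: quad_form_diagonalization[OF P A])
  from d_TV_diag_form[OF tr this] show ?thesis
    unfolding distr lp_norm_ratio_square using sums[of "\<lambda>t. t ^ 4"] sums[of "\<lambda>t. t\<^sup>2"] by simp
qed

end
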